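(* Let $G$ be an infinite finitely generated group with finite generating set $S_G$, and let $H$ be a finite group. Equip $H\wr G$ with the word metric with respect to the generating set $(H\setminus\{1\})\cup S_G$, and let $K$ be the kernel of the projection $H\wr G\to G$, equipped with the metric induced from $H\wr G$. If the growth function of $G$ is bounded by a linear function, then $\mathrm{dim}_{AN}(K)=0$ and $\mathrm{dim}_{AN}(H\wr G)=\mathrm{dim}_{AN}(G)=1$.
   Context: Wreath product: for groups $A,B$ let $A^{(B)}$ be the group of finitely supported functions $B\to A$, with $B$ acting by $(bf)(\gamma)=f(b^{-1}\gamma)$. Then $A\wr B$ is the set of pairs $(f,b)$ with $f\in A^{(B)}$, $b\in B$ and product $(f_1,b_1)(f_2,b_2)=(f_1\cdot(b_1f_2),b_1b_2)$. One identifies $b\in B$ with $(1,b)$ and $a\in A$ with $(f_a,1)$, where $f_a(1)=a$ and $f_a(\gamma)=1$ for $\gamma\neq 1$; the projection $H\wr G\to G$ is $(f,g)\mapsto g$. The word metric w.r.t. a generating set $S$ is $d(x,y)=$ length of $x^{-1}y$ as a word in $S\cup S^{-1}$. The growth function $\gamma$ of $G$ is $\gamma(r)=\#\{g\in G: |g|_{S_G}<r\}$; being bounded by a linear function does not depend on $S_G$. For a metric space $X$ and $r>0$, an $r$-path is a sequence $x_0,\dots,x_m$ with $d(x_j,x_{j+1})<r$; two points of $Y\subseteq X$ lie in the same $r$-component of $Y$ if they are joined by an $r$-path in $Y$. An $n$-dimensional control function of $X$ is a function $D:\mathbb{R}_+\to\mathbb{R}_+\cup\{\infty\}$ such that for every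 $r>0$ there is a cover $\{X_0,\dots,X_n\}$ of $X$ such that every open ball $B(x,r)$ is contained in some $X_i$ and every $r$-component of every $X_i$ has diameter at most $D(r)$. The Assouad–Nagata dimension $\mathrm{dim}_{AN}(X)$ is the smallest integer $n$ such that $X$ has an $n$-dimensional control function of the form $D(r)=C\cdot r$ for some constant $C>0$ (and $\infty$ if none exists). Groups are given their word metrics. *)

theory Defs
  imports "HOL-Algebra.Algebra" "HOL-Library.Extended_Nat"
begin

definition word_length :: "('a, 'b) monoid_scheme \<Rightarrow> 'a set \<Rightarrow> 'a \<Rightarrow> nat" where
  "word_length G S x =
     (LEAST n. \<exists>ws. length ws = n \<and> set ws \<subseteq> S \<union> (\<lambda>s. inv\<^bsub>G\<^esub> s) ` S
                 \<and> foldr (\<lambda>a b. a \<otimes>\<^bsub>G\<^esub> b) ws \<one>\<^bsub>G\<^esub> = x)"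

definition word_dist :: "('a, 'b) monoid_scheme \<Rightarrow> 'a set \<Rightarrow> 'a \<Rightarrow> 'a \<Rightarrow> real" where
  "word_dist G S x y = real (word_length G S (inv\<^bsub>G\<^esub> x \<otimes>\<^bsub>G\<^esub> y))"

definition growth :: "('a, 'b) monoid_scheme \<Rightarrow> 'a set \<Rightarrow> real \<Rightarrow> nat" where
  "growth G S r = card {g \<in> carrier G. real (word_length G S g) < r}"

definition linear_growth :: "('a, 'b) monoid_scheme \<Rightarrow> 'a set \<Rightarrow> bool" where
  "linear_growth G S \<longleftrightarrow> (\<exists>a b. \<forall>r>0. real (growth G S r) \<le> a * r + b)"

definition wr_carrier :: "('h, 'c) monoid_scheme \<Rightarrow> ('g, 'd) monoid_scheme \<Rightarrow> (('g \<Rightarrow> 'h) \<times> 'g) set" where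
  "wr_carrier H G = {(f, b). (\<forall>\<gamma>\<in>carrier G. f \<gamma> \<in> carrier H) \<and> (\<forall>\<gamma>. \<gamma> \<notin> carrier G \<longrightarrow> f \<gamma> = \<one>\<^bsub>H\<^esub>)
       \<and> finite {\<gamma> \<in> carrier G. f \<gamma> \<noteq> \<one>\<^bsub>H\<^esub>} \<and> b \<in> carrier G}"

definition wr_mult :: "('h, 'c) monoid_scheme \<Rightarrow> ('g, 'd) monoid_scheme \<Rightarrow>
    ('g \<Rightarrow> 'h) \<times> 'g \<Rightarrow> ('g \<Rightarrow> 'h) \<times> 'g \<Rightarrow> ('g \<Rightarrow> 'h) \<times> 'g" where
  "wr_mult H G x y =
     ((\<lambda>\<gamma>. if \<gamma> \<in> carrier G then fst x \<gamma> \<otimes>\<^bsub>H\<^esub> fst y (inv\<^bsub>G\<^esub> (snd x) \<otimes>\<^bsub>G\<^esub> \<gamma>) else \<one>\<^bsub>H\<^esub>),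
      snd x \<otimes>\<^bsub>G\<^esub> snd y)"

text \<open>The wreath product H wr G: (f1,b1)(f2,b2) = (f1 (b1 f2), b1 b2) with (b f)(g) = f(b^-1 g).\<close>
definition wreath :: "('h, 'c) monoid_scheme \<Rightarrow> ('g, 'd) monoid_scheme \<Rightarrow> (('g \<Rightarrow> 'h) \<times> 'g) monoid" where
  "wreath H G = \<lparr>carrier = wr_carrier H G, monoid.mult = wr_mult H G,
                 one = (\<lambda>_. \<one>\<^bsub>H\<^esub>, \<one>\<^bsub>G\<^esub>)\<rparr>"

definition wr_embH :: "('h, 'c) monoid_scheme \<Rightarrow> ('g, 'd) monoid_scheme \<Rightarrow> 'h \<Rightarrow> ('g \<Rightarrow> 'h) \<times> 'g" where
  "wr_embH H G a = ((\<lambda>\<gamma>. if \<gamma> = \<one>\<^bsub>G\<^esub> then a else \<one>\<^bsub>H\<^esub>), \<one>\<^bsub>G\<^esub>)"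

definition wr_embG :: "('h, 'c) monoid_scheme \<Rightarrow> ('g, 'd) monoid_scheme \<Rightarrow> 'g \<Rightarrow> ('g \<Rightarrow> 'h) \<times> 'g" where
  "wr_embG H G b = ((\<lambda>_. \<one>\<^bsub>H\<^esub>), b)"

definition wr_gens :: "('h, 'c) monoid_scheme \<Rightarrow> ('g, 'd) monoid_scheme \<Rightarrow> 'g set \<Rightarrow> (('g \<Rightarrow> 'h) \<times> 'g) set" where
  "wr_gens H G S = wr_embH H G ` (carrier H - {\<one>\<^bsub>H\<^esub>}) \<union> wr_embG H G ` S"

definition wr_kernel :: "('h, 'c) monoid_scheme \<Rightarrow> ('g, 'd) monoid_scheme \<Rightarrow> (('g \<Rightarrow> 'h) \<times> 'g) set" where
  "wr_kernel H G = {x \<in> wr_carrier H G. snd x = \<one>\<^bsub>G\<^esub>}"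

definition open_ball :: "'a set \<Rightarrow> ('a \<Rightarrow> 'a \<Rightarrow> real) \<Rightarrow> 'a \<Rightarrow> real \<Rightarrow> 'a set" where
  "open_ball M d x r = {y \<in> M. d x y < r}"

definition same_r_component :: "('a \<Rightarrow> 'a \<Rightarrow> real) \<Rightarrow> real \<Rightarrow> 'a set \<Rightarrow> 'a \<Rightarrow> 'a \<Rightarrow> bool" where
  "same_r_component d r Y x y \<longleftrightarrow>
     (\<exists>ps. ps \<noteq> [] \<and> hd ps = x \<and> last ps = y \<and> set ps \<subseteq> Y \<and>
           (\<forall>j. Suc j < length ps \<longrightarrow> d (ps ! j) (ps ! Suc j) < r))"

definition control_function :: "'a set \<Rightarrow> ('a \<Rightarrow> 'a \<Rightarrow> real) \<Rightarrow> nat \<Rightarrow> (real \<Rightarrow> real) \<Rightarrow> bool" where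
  "control_function M d n D \<longleftrightarrow>
     (\<forall>r>0. \<exists>U :: nat \<Rightarrow> 'a set.
        (\<forall>i\<le>n. U i \<subseteq> M) \<and> M = (\<Union>i\<le>n. U i) \<and>
        (\<forall>x\<in>M. \<exists>i\<le>n. open_ball M d x r \<subseteq> U i) \<and>
        (\<forall>i\<le>n. \<forall>x y. same_r_component d r (U i) x y \<longrightarrow> d x y \<le> D r))"

definition has_linear_control :: "'a set \<Rightarrow> ('a \<Rightarrow> 'a \<Rightarrow> real) \<Rightarrow> nat \<Rightarrow> bool" where
  "has_linear_control M d n \<longleftrightarrow> (\<exists>C>0. control_function M d n (\<lambda>r. C * r))"

definition dim_AN :: "'a set \<Rightarrow> ('a \<Rightarrow> 'a \<Rightarrow> real) \<Rightarrow> enat" where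
  "dim_AN M d = (if \<exists>n. has_linear_control M d n
                 then enat (LEAST n. has_linear_control M d n) else \<infinity>)"

end

theory Submission
  imports Defs
begin

text \<open>
  The heart of the matter is that a space whose balls satisfy \<open>n \<le> |B(x,n)| \<le> A n\<close> has linearly
  controlled dimension at most 1. Fix a scale \<open>n\<close> and a large constant \<open>R\<close> depending only on \<open>A\<close>,
  and take a maximal \<open>R n\<close>-separated net. By averaging, around each net point there is a sphere
  of radius between \<open>R n\<close> and \<open>9 R n\<close> whose \<open>4 n\<close>-thickening has at most \<open>9 A n\<close> points. Off the
  spheres, a path with steps at most \<open>n\<close> is confined to a ball; near the spheres it cannot get
  further than \<open>R n\<close>, because a long path needs many disjoint \<open>n\<close>-balls while the boundedly many
  thin annuli near its starting point contain too few points. The lower bound on balls holds in any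
  infinite finitely generated group.

  The cover of \<open>G\<close> pulls back to the wreath product: along a path whose cursor stays within
  distance \<open>C n\<close>, only lamps in a ball of radius \<open>(C + 1) n\<close> change, and by linear growth a
  depth-first tour of that ball has length linear in \<open>n\<close>. On the kernel the cursor does not move at
  all, so no cover is needed. Infinite groups are connected at scale 2, which excludes dimension 0.
\<close>

section \<open>Integer-valued metrics of linear growth\<close>

locale nat_metric =
  fixes M :: "'a set" and \<delta> :: "'a \<Rightarrow> 'a \<Rightarrow> nat"
  assumes dist_refl: "x \<in> M \<Longrightarrow> \<delta> x x = 0"
    and dist_sym: "x \<in> M \<Longrightarrow> y \<in> M \<Longrightarrow> \<delta> x y = \<delta> y x"
    and dist_triangle: "x \<in> M \<Longrightarrow> y \<in> M \<Longrightarrow> z \<in> M \<Longrightarrow> \<delta> x z \<le> \<delta> x y + \<delta> y z"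
begin

abbreviation closed_ball where "closed_ball x n \<equiv> {y \<in> M. \<delta> x y \<le> n}"

text \<open>Integer-scale counterpart of an r-component. A step records only that its target lies in
  \<open>Y\<close>, so membership of the starting point is assumed separately where it
  matters.\<close>

abbreviation reachable where "reachable n Y \<equiv> (\<lambda>u v. v \<in> Y \<and> \<delta> u v \<le> n)\<^sup>*\<^sup>*"

text \<open>Linear control at positive integer scales, with closed balls and steps of length at most
  \<open>n\<close>. That the sets cover \<open>M\<close> is implied, since every point lies in its
  own ball.\<close>

definition nat_control where
  "nat_control k C \<longleftrightarrow> (\<forall>n\<ge>1. \<exists>U :: nat \<Rightarrow> 'a set. (\<forall>i\<le>k. U i \<subseteq> M) \<and>
     (\<forall>x\<in>M. \<exists>i\<le>k. closed_ball x n \<subseteq> U i) \<and>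
     (\<forall>i\<le>k. \<forall>x\<in>U i. \<forall>y. reachable n (U i) x y \<longrightarrow> \<delta> x y \<le> C * n))"

lemma reachable_closed: "reachable n Y x y \<Longrightarrow> x \<in> Y \<Longrightarrow> y \<in> Y"
  by (induction rule: rtranclp_induct) auto

lemma same_r_component_reachable:
  assumes "same_r_component (\<lambda>x y. real (\<delta> x y)) r Y x y" "r \<le> real n"
  shows "x \<in> Y" "reachable n Y x y"
proof -
  obtain ps where ps: "ps \<noteq> []" "hd ps = x" "last ps = y" "set ps \<subseteq> Y"
    "\<And>j. Suc j < length ps \<Longrightarrow> real (\<delta> (ps ! j) (ps ! Suc j)) < r"
    using assms(1) unfolding same_r_component_def by blast
  show "x \<in> Y" using ps by auto
  have "reachable n Y (ps ! 0) (ps ! j)" if "j < length ps" for j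
    using that
  proof (induction j)
    case (Suc j)
    then have "real (\<delta> (ps ! j) (ps ! Suc j)) < real n" using ps(5)[of j] assms(2) by simp
    moreover have "ps ! Suc j \<in> Y" using ps(4) Suc.prems nth_mem by blast
    moreover have "reachable n Y (ps ! 0) (ps ! j)" using Suc by simp
    ultimately show ?case by (simp add: rtranclp.rtrancl_into_rtrancl)
  qed simp
  from this[of "length ps - 1"] show "reachable n Y x y"
    using ps by (simp add: hd_conv_nth last_conv_nth)
qed

text \<open>Rounding \<open>r > 1\<close> up to an integer at most doubles it. For
  \<open>r \<le> 1\<close> integrality forces every step to have length 0, so the trivial cover
  works. The summand 1 keeps the constant positive when \<open>C = 0\<close>.\<close>

lemma nat_control_imp_linear_control:
  assumes "nat_control k C"
  shows "has_linear_control M (\<lambda>x y. real (\<delta> x y)) k"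
  unfolding has_linear_control_def control_function_def
proof (intro exI[of _ "2 * real C + 1"] conjI allI impI)
  fix r :: real assume "r > 0"
  show "\<exists>U. (\<forall>i\<le>k. U i \<subseteq> M) \<and> M = (\<Union>i\<le>k. U i) \<and>
      (\<forall>x\<in>M. \<exists>i\<le>k. open_ball M (\<lambda>x y. real (\<delta> x y)) x r \<subseteq> U i) \<and>
      (\<forall>i\<le>k. \<forall>x y. same_r_component (\<lambda>x y. real (\<delta> x y)) r (U i) x y \<longrightarrow>
        real (\<delta> x y) \<le> (2 * real C + 1) * r)"
  proof (cases "r \<le> 1")
    case True
    have "real (\<delta> x y) \<le> (2 * real C + 1) * r"
      if c: "same_r_component (\<lambda>x y. real (\<delta> x y)) r M x y" for x y
    proof -
      obtain ps where ps: "ps \<noteq> []" "hd ps = x" "last ps = y" "set ps \<subseteq> M"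
        "\<And>j. Suc j < length ps \<Longrightarrow> real (\<delta> (ps ! j) (ps ! Suc j)) < r"
        using c unfolding same_r_component_def by blast
      have "\<delta> (ps ! 0) (ps ! j) = 0" if "j < length ps" for j
        using that
      proof (induction j)
        case 0
        then show ?case using ps(4) dist_refl nth_mem by blast
      next
        case (Suc j)
        then have "real (\<delta> (ps ! j) (ps ! Suc j)) < 1" using ps(5)[of j] True by simp
        moreover have "ps ! 0 \<in> M" "ps ! j \<in> M" "ps ! Suc j \<in> M"
          using ps(4) Suc.prems by (auto intro!: subsetD[OF ps(4)] nth_mem)
        ultimately show ?case
          using Suc dist_triangle[of "ps ! 0" "ps ! j" "ps ! Suc j"] by simp
      qed
      from this[of "length ps - 1"] have "\<delta> x y = 0"
        using ps by (simp add: hd_conv_nth last_conv_nth)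
      with \<open>r > 0\<close> show ?thesis by simp
    qed
    then show ?thesis by (intro exI[of _ "\<lambda>_. M"]) (auto simp: open_ball_def)
  next
    case False
    define n where "n = nat \<lceil>r\<rceil>"
    have n: "n \<ge> 1" "r \<le> real n" "real n \<le> 2 * r"
      using False unfolding n_def by linarith+
    obtain U where U: "\<forall>i\<le>k. U i \<subseteq> M" "\<forall>x\<in>M. \<exists>i\<le>k. closed_ball x n \<subseteq> U i"
      "\<forall>i\<le>k. \<forall>x\<in>U i. \<forall>y. reachable n (U i) x y \<longrightarrow> \<delta> x y \<le> C * n"
      using assms[unfolded nat_control_def, rule_format, OF n(1)] by (elim exE conjE)
    have sub: "open_ball M (\<lambda>x y. real (\<delta> x y)) x r \<subseteq> closed_ball x n" for x
      using n(2) by (auto simp: open_ball_def)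
    show ?thesis
    proof (intro exI[of _ U] conjI allI impI ballI)
      show "M = (\<Union>i\<le>k. U i)"
      proof (intro equalityI subsetI)
        fix x assume x: "x \<in> M"
        with U(2) dist_refl[OF x] show "x \<in> (\<Union>i\<le>k. U i)" by force
      qed (use U(1) in auto)
      show "\<exists>i\<le>k. open_ball M (\<lambda>x y. real (\<delta> x y)) x r \<subseteq> U i" if "x \<in> M" for x
        using U(2) that sub by blast
      fix i x y assume "i \<le> k" "same_r_component (\<lambda>x y. real (\<delta> x y)) r (U i) x y"
      then have "\<delta> x y \<le> C * n"
        using same_r_component_reachable[OF _ n(2), of "U i" x y] U(3) by blast
      then have "real (\<delta> x y) \<le> real C * real n"
        by (simp flip: of_nat_mult)
      also have "\<dots> \<le> real C * (2 * r)" using n(3) by (intro mult_left_mono) auto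
      also have "\<dots> \<le> (2 * real C + 1) * r" using \<open>r > 0\<close> by (simp add: algebra_simps)
      finally show "real (\<delta> x y) \<le> (2 * real C + 1) * r" .
    qed (use U(1) in auto)
  qed
qed simp

text \<open>A maximal \<open>m\<close>-separated set is a net: a point farther than \<open>m\<close>
  from all of it could be added. Zorn's lemma applies because two points in the union of a chain lie
  in a common member.\<close>

lemma ex_separated_net:
  obtains P where "P \<subseteq> M" "\<And>p q. p \<in> P \<Longrightarrow> q \<in> P \<Longrightarrow> p \<noteq> q \<Longrightarrow> m < \<delta> p q"
    "\<And>x. x \<in> M \<Longrightarrow> \<exists>p\<in>P. \<delta> p x \<le> m"
proof -
  define F where "F = {P. P \<subseteq> M \<and> (\<forall>p\<in>P. \<forall>q\<in>P. p \<noteq> q \<longrightarrow> m < \<delta> p q)}"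
  have "\<Union>\<C> \<in> F" if "subset.chain F \<C>" for \<C>
  proof -
    have "m < \<delta> p q" if pq: "p \<in> \<Union>\<C>" "q \<in> \<Union>\<C>" "p \<noteq> q" for p q
    proof -
      obtain P Q where "P \<in> \<C>" "Q \<in> \<C>" "p \<in> P" "q \<in> Q" using pq by blast
      moreover have "P \<subseteq> Q \<or> Q \<subseteq> P" "P \<in> F" "Q \<in> F"
        using \<open>subset.chain F \<C>\<close> \<open>P \<in> \<C>\<close> \<open>Q \<in> \<C>\<close> unfolding subset_chain_def by blast+
      ultimately show ?thesis using pq(3) unfolding F_def by blast
    qed
    moreover have "\<Union>\<C> \<subseteq> M" using \<open>subset.chain F \<C>\<close> by (auto simp: subset_chain_def F_def)
    ultimately show ?thesis by (simp add: F_def)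
  qed
  from subset_Zorn'[of F, OF this] obtain P where
    P: "P \<in> F" "\<And>Q. Q \<in> F \<Longrightarrow> P \<subseteq> Q \<Longrightarrow> Q = P"
    by blast
  have "\<exists>p\<in>P. \<delta> p x \<le> m" if x: "x \<in> M" for x
  proof (rule ccontr)
    assume "\<not> ?thesis"
    then have far: "m < \<delta> p x" if "p \<in> P" for p using that by force
    moreover have "\<delta> p x = \<delta> x p" if "p \<in> P" for p using P(1) that x dist_sym unfolding F_def by blast
    ultimately have "insert x P \<in> F" using P(1) x by (auto simp: F_def)
    with P(2) have "x \<in> P" by blast
    with far[of x] dist_refl[OF x] show False by simp
  qed
  with P(1) that[of P] show thesis by (simp add: F_def)
qed

text \<open>Discrete intermediate value argument: the first step that reaches distance
  \<open>c\<close> starts below \<open>c\<close> and overshoots by at most \<open>n\<close>.\<close>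

lemma ex_reachable_at_distance:
  assumes "x \<in> M" "Y \<subseteq> M" "x \<in> Y" "reachable n Y x y" "c \<le> \<delta> x y"
  shows "\<exists>z\<in>Y. c \<le> \<delta> x z \<and> \<delta> x z \<le> c + n"
  using assms(4,5)
proof (induction rule: rtranclp_induct)
  case base
  then show ?case using assms(3) dist_refl[OF assms(1)] by force
next
  case (step y z)
  show ?case
  proof (cases "c \<le> \<delta> x y")
    case True
    then show ?thesis using step by blast
  next
    case False
    have "y \<in> Y" using reachable_closed[OF step(1) assms(3)] .
    then have "\<delta> x z \<le> \<delta> x y + \<delta> y z" using assms step by (intro dist_triangle) auto
    then show ?thesis using step False by force
  qed
qed

end

section \<open>Packing estimates and control in dimension 1\<close>

locale linear_growth_metric = nat_metric +
  fixes A :: nat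
  assumes finite_ball: "x \<in> M \<Longrightarrow> finite (closed_ball x n)"
    and card_ball_ge: "x \<in> M \<Longrightarrow> n \<le> card (closed_ball x n)"
    and card_ball_le: "x \<in> M \<Longrightarrow> 1 \<le> n \<Longrightarrow> card (closed_ball x n) \<le> A * n"
begin

text \<open>Packing: the \<open>m\<close>-balls around the points of \<open>Q\<close> are pairwise
  disjoint, and each has at least \<open>m\<close> points.\<close>

lemma card_separated_le:
  assumes "Q \<subseteq> M" "finite Q" "\<And>p q. p \<in> Q \<Longrightarrow> q \<in> Q \<Longrightarrow> p \<noteq> q \<Longrightarrow> 2 * m < \<delta> p q"
    "\<And>p. p \<in> Q \<Longrightarrow> closed_ball p m \<subseteq> V" "finite V"
  shows "card Q * m \<le> card V"
proof -
  have disj: "closed_ball p m \<inter> closed_ball q m = {}" if "p \<in> Q" "q \<in> Q" "p \<noteq> q" for p q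
  proof (rule ccontr)
    assume "\<not> ?thesis"
    then obtain y where y: "y \<in> M" "\<delta> p y \<le> m" "\<delta> q y \<le> m" by blast
    have "\<delta> p q \<le> \<delta> p y + \<delta> y q" "\<delta> q y = \<delta> y q"
      using y that assms(1) by (auto intro!: dist_triangle dist_sym)
    with y assms(3)[OF that] show False by linarith
  qed
  have "card Q * m = (\<Sum>p\<in>Q. m)" by simp
  also have "\<dots> \<le> (\<Sum>p\<in>Q. card (closed_ball p m))"
    using assms(1) by (intro sum_mono card_ball_ge) auto
  also have "\<dots> = card (\<Union>p\<in>Q. closed_ball p m)"
    using assms(1,2) disj finite_ball by (intro card_UN_disjoint[symmetric]) auto
  also have "\<dots> \<le> card V" using assms(4,5) by (intro card_mono) auto
  finally show ?thesis .
qed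

text \<open>Averaging over \<open>R\<close> disjoint annuli of width \<open>8 n\<close>: one of them has at most \<open>9 A n\<close> points,
  a bound that does not depend on \<open>R\<close>.\<close>

lemma ex_thin_annulus:
  assumes "p \<in> M" "1 \<le> n" "1 \<le> R"
  obtains t where "R * n \<le> t" "t + 8 * n \<le> 9 * R * n"
    "card {y \<in> M. t < \<delta> p y \<and> \<delta> p y \<le> t + 8 * n} \<le> 9 * A * n"
proof -
  \<comment> \<open>These half-open annuli tile the distances from \<open>R * n\<close> to
    \<open>9 * R * n\<close>; hence they are disjoint and lie in a single ball of radius
    \<open>9 * R * n\<close>.\<close>
  define W where "W j = {y \<in> M. R * n + 8 * j * n < \<delta> p y \<and> \<delta> p y \<le> R * n + 8 * j * n + 8 * n}" for j
  have bound: "R * n + 8 * j * n + 8 * n \<le> 9 * R * n" if "j < R" for j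
  proof -
    have "(8 * (j + 1)) * n \<le> (8 * R) * n" using that by (intro mult_right_mono) auto
    then show ?thesis by (simp add: algebra_simps)
  qed
  have sub: "W j \<subseteq> closed_ball p (9 * R * n)" if "j < R" for j
    using bound[OF that] by (auto simp: W_def)
  have disj: "W i \<inter> W j = {}" if "i < j" for i j
  proof -
    have "(8 * (i + 1)) * n \<le> (8 * j) * n" using that by (intro mult_right_mono) auto
    then show ?thesis by (auto simp: W_def algebra_simps)
  qed
  have fin: "finite (W j)" if "j < R" for j
    using sub[OF that] finite_ball[OF assms(1)] finite_subset by blast
  have "\<exists>j<R. card (W j) \<le> 9 * A * n"
  proof (rule ccontr)
    assume "\<not> ?thesis"
    \<comment> \<open>The union would have at least \<open>R * (9 * A * n + 1)\<close> points,
      against at most \<open>A * (9 * R * n)\<close> in the ball.\<close>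
    then have "(\<Sum>j<R. 9 * A * n + 1) \<le> (\<Sum>j<R. card (W j))"
      by (intro sum_mono) (force simp: not_le)
    also have "\<dots> = card (\<Union>j<R. W j)"
    proof (intro card_UN_disjoint[symmetric] ballI impI)
      fix i j :: nat assume "i \<noteq> j"
      then show "W i \<inter> W j = {}" using disj[of i j] disj[of j i] by (cases "i < j") auto
    qed (use fin in auto)
    also have "\<dots> \<le> card (closed_ball p (9 * R * n))"
      using sub finite_ball[OF assms(1)] by (intro card_mono) auto
    also have "\<dots> \<le> A * (9 * R * n)"
      using assms by (intro card_ball_le) auto
    finally show False using assms(3) by (simp add: algebra_simps)
  qed
  then obtain j where "j < R" "card (W j) \<le> 9 * A * n" by blast
  with that[of "R * n + 8 * j * n"] bound show thesis by (simp add: W_def)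
qed

lemma linear_growth_control: "nat_control 1 (72 * (189 * A * A + 1))"
  unfolding nat_control_def
proof (intro allI impI)
  fix n :: nat assume n: "1 \<le> n"
  \<comment> \<open>Here \<open>189 = 21 * 9\<close> comes from the count of points in thin annuli
    below. With \<open>R = 4 * K\<close> there is room for \<open>K\<close> points at distance steps
    of \<open>4 * n\<close> within \<open>R * n\<close>, and the final bound
    \<open>72 * K * n\<close> is \<open>18 * R * n\<close>, the diameter bound off the
    spheres.\<close>
  define K where "K = 189 * A * A + 1"
  define R where "R = 4 * K"
  have KR: "1 \<le> K" "1 \<le> R" by (simp_all add: K_def R_def)
  obtain P where P: "P \<subseteq> M" "\<And>p q. p \<in> P \<Longrightarrow> q \<in> P \<Longrightarrow> p \<noteq> q \<Longrightarrow> R * n < \<delta> p q"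
    "\<And>x. x \<in> M \<Longrightarrow> \<exists>p\<in>P. \<delta> p x \<le> R * n"
    using ex_separated_net[of "R * n"] by blast
  have "\<forall>p\<in>P. \<exists>t. R * n \<le> t \<and> t + 8 * n \<le> 9 * R * n \<and>
      card {y \<in> M. t < \<delta> p y \<and> \<delta> p y \<le> t + 8 * n} \<le> 9 * A * n"
    using ex_thin_annulus[of _ n R] P(1) n KR by blast
  from bchoice[OF this] obtain t where t: "\<And>p. p \<in> P \<Longrightarrow> R * n \<le> t p"
    "\<And>p. p \<in> P \<Longrightarrow> t p + 8 * n \<le> 9 * R * n"
    "\<And>p. p \<in> P \<Longrightarrow> card {y \<in> M. t p < \<delta> p y \<and> \<delta> p y \<le> t p + 8 * n} \<le> 9 * A * n"
    by blast
  \<comment> \<open>Offsets are multiples of \<open>n\<close> beyond the inner radius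
    \<open>t p\<close>. The shell from 4 to 5 is removed from \<open>U1\<close>; an
    \<open>n\<close>-ball meeting it lies in the shell from 2 to 7, which belongs to
    \<open>U0\<close>; \<open>n\<close>-balls around points of the latter lie in the shell from 0 to
    8, whose size is bounded by the choice of \<open>t\<close>.\<close>
  define annulus where "annulus p a b = {y \<in> M. t p + a * n < \<delta> p y \<and> \<delta> p y \<le> t p + b * n}"
    for p and a b :: nat
  define U0 where "U0 = (\<Union>p\<in>P. annulus p 2 7)"
  define U1 where "U1 = M - (\<Union>p\<in>P. annulus p 4 5)"
  have sub: "U0 \<subseteq> M" "U1 \<subseteq> M" by (auto simp: U0_def U1_def annulus_def)

  have cover: "closed_ball x n \<subseteq> U0 \<or> closed_ball x n \<subseteq> U1" if x: "x \<in> M" for x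
  proof (rule disjCI)
    assume "\<not> closed_ball x n \<subseteq> U1"
    then obtain z p where z: "z \<in> M" "\<delta> x z \<le> n" "p \<in> P" "z \<in> annulus p 4 5"
      by (auto simp: U1_def)
    have p: "p \<in> M" using z P(1) by blast
    have "y \<in> annulus p 2 7" if y: "y \<in> M" "\<delta> x y \<le> n" for y
    proof -
      have "\<delta> z y \<le> \<delta> x z + \<delta> x y"
        using dist_triangle[OF z(1) x y(1)] dist_sym[OF z(1) x] by simp
      moreover have "\<delta> p y \<le> \<delta> p z + \<delta> z y" "\<delta> p z \<le> \<delta> p y + \<delta> z y"
        using dist_triangle[OF p z(1) y(1)] dist_triangle[OF p y(1) z(1)] dist_sym[OF z(1) y(1)]
        by simp_all
      ultimately show ?thesis using z y by (auto simp: annulus_def)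
    qed
    then show "closed_ball x n \<subseteq> U0" using z(3) by (auto simp: U0_def)
  qed

  have comp1: "\<delta> x y \<le> 72 * K * n" if x: "x \<in> U1" and r: "reachable n U1 x y" for x y
  proof -
    have xM: "x \<in> M" using x sub by blast
    obtain p where p: "p \<in> P" "\<delta> p x \<le> R * n" using P(3)[OF xM] by blast
    have pM: "p \<in> M" using p P(1) by blast
    \<comment> \<open>A step of length at most \<open>n\<close> cannot jump over the removed shell,
      which has width \<open>n\<close>. The path starts on the inner side because \<open>x\<close>
      is within \<open>R * n \<le> t p\<close> of \<open>p\<close>.\<close>
    have "\<delta> p y \<le> t p + 4 * n"
      using r
    proof (induction rule: rtranclp_induct)
      case base
      then show ?case using p t(1)[OF p(1)] by simp
    next
      case (step y z)
      have "y \<in> M" "z \<in> M" using reachable_closed[OF step(1) x] step(2) sub by auto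
      then have "\<delta> p z \<le> \<delta> p y + \<delta> y z" using pM by (intro dist_triangle)
      moreover have "z \<notin> annulus p 4 5" using step(2) p(1) by (auto simp: U1_def)
      ultimately show ?case using step \<open>z \<in> M\<close> by (auto simp: annulus_def)
    qed
    moreover have yM: "y \<in> M" using reachable_closed[OF r x] sub by auto
    moreover have "\<delta> x y \<le> \<delta> p x + \<delta> p y"
      using dist_triangle[OF xM pM yM] dist_sym[OF xM pM] by simp
    ultimately have "\<delta> x y \<le> 18 * (R * n)" using p(2) t(2)[OF p(1)] by simp
    then show ?thesis by (simp add: R_def)
  qed

  text \<open>A point of the component at distance more than \<open>4 K n\<close> would provide \<open>K\<close> disjoint
    \<open>n\<close>-balls inside the thin annuli that meet a ball of radius \<open>R n\<close>. There are at most
    \<open>21 A\<close> such annuli, with \<open>9 A n\<close> points each, and \<open>K\<close> exceeds \<open>21 A \<cdot> 9 A\<close>.\<close>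

  have comp0: "\<delta> x y \<le> 72 * K * n" if x: "x \<in> U0" and r: "reachable n U0 x y" for x y
  proof (rule ccontr)
    assume far: "\<not> ?thesis"
    have xM: "x \<in> M" using x sub by blast
    \<comment> \<open>One point is chosen for each distance range from \<open>4 * k * n\<close> to
      \<open>4 * k * n + n\<close>. Successive ranges have gaps of \<open>3 * n\<close>, so the
      points are more than \<open>2 * n\<close> apart.\<close>
    have "\<exists>z. z \<in> U0 \<and> 4 * k * n \<le> \<delta> x z \<and> \<delta> x z \<le> 4 * k * n + n" if "k < K" for k
      unfolding Bex_def[symmetric]
    proof (rule ex_reachable_at_distance[OF xM sub(1) x r])
      have "4 * k * n \<le> 72 * K * n" using that by (intro mult_right_mono) auto
      then show "4 * k * n \<le> \<delta> x y" using far by linarith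
    qed
    then have "\<forall>k\<in>{..<K}. \<exists>z. z \<in> U0 \<and> 4 * k * n \<le> \<delta> x z \<and> \<delta> x z \<le> 4 * k * n + n" by blast
    from bchoice[OF this] obtain z where z: "\<And>k. k < K \<Longrightarrow> z k \<in> U0" "\<And>k. k < K \<Longrightarrow> 4 * k * n \<le> \<delta> x (z k)"
      "\<And>k. k < K \<Longrightarrow> \<delta> x (z k) \<le> 4 * k * n + n"
      by blast
    have zM: "z k \<in> M" if "k < K" for k using z(1)[OF that] sub by blast
    have sep1: "2 * n < \<delta> (z k) (z l)" if "k < l" "l < K" for k l
    proof -
      have "4 * (k + 1) * n \<le> 4 * l * n" using that by (intro mult_right_mono) auto
      then have "4 * k * n + 4 * n \<le> 4 * l * n" by (simp add: algebra_simps)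
      moreover have "\<delta> x (z l) \<le> \<delta> x (z k) + \<delta> (z k) (z l)"
        using xM zM that by (intro dist_triangle) auto
      ultimately show ?thesis
        using z(3)[of k] z(2)[of l] that n by linarith
    qed
    have sep: "2 * n < \<delta> (z k) (z l)" if "k \<noteq> l" "k < K" "l < K" for k l
      using sep1[of k l] sep1[of l k] that dist_sym[OF zM zM, of k l] by (cases "k < l") auto
    have inj: "inj_on z {..<K}"
    proof (rule inj_onI, rule ccontr)
      fix k l assume "k \<in> {..<K}" "l \<in> {..<K}" "z k = z l" "k \<noteq> l"
      then show False using sep[of k l] dist_refl[OF zM, of k] by simp
    qed
    \<comment> \<open>The radius is \<open>R * n + 9 * R * n\<close>: every \<open>z k\<close> is
      within \<open>R * n\<close> of \<open>x\<close>, and within \<open>9 * R * n\<close> of a net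
      point whose annulus contains it.\<close>
    define Q where "Q = P \<inter> closed_ball x (10 * R * n)"
    define V where "V = (\<Union>p\<in>Q. annulus p 0 8)"
    have QM: "Q \<subseteq> M" "finite Q" using P(1) finite_ball[OF xM] by (auto simp: Q_def)
    \<comment> \<open>Net points are more than \<open>R * n = 4 * K * n\<close> apart, so their
      balls of radius \<open>2 * K * n\<close> are disjoint. They fit into radius
      \<open>10 * R * n + 2 * K * n = 42 * K * n\<close> around \<open>x\<close>.\<close>
    have "card Q * (2 * K * n) \<le> card (closed_ball x (42 * K * n))"
    proof (rule card_separated_le)
      show "2 * (2 * K * n) < \<delta> p q" if "p \<in> Q" "q \<in> Q" "p \<noteq> q" for p q
        using P(2)[of p q] that by (auto simp: Q_def R_def)
      show "closed_ball p (2 * K * n) \<subseteq> closed_ball x (42 * K * n)" if "p \<in> Q" for p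
      proof
        fix y assume y: "y \<in> closed_ball p (2 * K * n)"
        then have "\<delta> x y \<le> \<delta> x p + \<delta> p y" using xM that QM by (intro dist_triangle) auto
        then show "y \<in> closed_ball x (42 * K * n)"
          using y that by (auto simp: Q_def R_def)
      qed
    qed (use QM finite_ball[OF xM] in auto)
    also have "\<dots> \<le> A * (42 * K * n)"
      using n KR by (intro card_ball_le[OF xM]) auto
    finally have "card Q * (2 * K * n) \<le> (21 * A) * (2 * K * n)" by (simp add: algebra_simps)
    then have cardQ: "card Q \<le> 21 * A" using n KR by simp
    have finV: "finite V"
      unfolding V_def
    proof (intro finite_UN_I QM(2))
      fix p assume "p \<in> Q"
      then have "annulus p 0 8 \<subseteq> closed_ball p (t p + 8 * n)" by (auto simp: annulus_def)
      with \<open>p \<in> Q\<close> QM(1) finite_ball show "finite (annulus p 0 8)" using finite_subset by blast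
    qed
    have "card V \<le> (\<Sum>p\<in>Q. card (annulus p 0 8))"
      unfolding V_def by (rule card_UN_le[OF QM(2)])
    also have "\<dots> \<le> card Q * (9 * A * n)"
      using t(3) sum_bounded_above[of Q "\<lambda>p. card (annulus p 0 8)" "9 * A * n"]
      by (auto simp: annulus_def Q_def)
    also have "\<dots> \<le> (21 * A) * (9 * A * n)" using cardQ by (intro mult_right_mono) auto
    finally have cardV: "card V \<le> 189 * A * A * n" by simp
    have "card (z ` {..<K}) * n \<le> card V"
    proof (rule card_separated_le)
      show "2 * n < \<delta> p q" if "p \<in> z ` {..<K}" "q \<in> z ` {..<K}" "p \<noteq> q" for p q
      proof -
        obtain k l where "k < K" "l < K" "p = z k" "q = z l" using \<open>p \<in> _\<close> \<open>q \<in> _\<close> by blast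
        with that(3) show ?thesis using sep[of k l] by blast
      qed
      fix p assume "p \<in> z ` {..<K}"
      then obtain k where k: "k < K" "p = z k" by auto
      obtain q where q: "q \<in> P" "z k \<in> annulus q 2 7" using z(1)[OF k(1)] by (auto simp: U0_def)
      have qM: "q \<in> M" using q P(1) by blast
      show "closed_ball p n \<subseteq> V"
      proof
        fix y assume y: "y \<in> closed_ball p n"
        then have yM: "y \<in> M" and zy: "\<delta> (z k) y \<le> n" using k by auto
        have "\<delta> q y \<le> \<delta> q (z k) + \<delta> (z k) y" "\<delta> q (z k) \<le> \<delta> q y + \<delta> (z k) y"
          using dist_triangle[OF qM zM[OF k(1)] yM] dist_triangle[OF qM yM zM[OF k(1)]]
            dist_sym[OF yM zM[OF k(1)]] by simp_all
        then have "y \<in> annulus q 0 8" using q(2) zy yM by (auto simp: annulus_def)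
        moreover have "q \<in> Q"
        proof -
          have "4 * (k + 1) * n \<le> 4 * K * n" using k by (intro mult_right_mono) auto
          then have "4 * k * n + 4 * n \<le> R * n" by (simp add: R_def algebra_simps)
          then have "\<delta> x (z k) \<le> R * n" using z(3)[OF k(1)] by linarith
          moreover have "\<delta> q (z k) \<le> 9 * R * n" using q(2) t(2)[OF q(1)] by (simp add: annulus_def)
          moreover have "\<delta> x q \<le> \<delta> x (z k) + \<delta> q (z k)"
            using dist_triangle[OF xM zM[OF k(1)] qM] dist_sym[OF qM zM[OF k(1)]] by simp
          ultimately show ?thesis using q(1) qM by (simp add: Q_def)
        qed
        ultimately show "y \<in> V" by (auto simp: V_def)
      qed
    qed (use zM finV in auto)
    then have "K * n \<le> card V" using inj by (simp add: card_image)
    then have "K * n \<le> 189 * A * A * n" using cardV by (rule order_trans)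
    then show False using n by (simp add: K_def)
  qed

  show "\<exists>U :: nat \<Rightarrow> 'a set. (\<forall>i\<le>1. U i \<subseteq> M) \<and> (\<forall>x\<in>M. \<exists>i\<le>1. closed_ball x n \<subseteq> U i) \<and>
      (\<forall>i\<le>1. \<forall>x\<in>U i. \<forall>y. reachable n (U i) x y \<longrightarrow>
        \<delta> x y \<le> 72 * (189 * A * A + 1) * n)"
  proof (intro exI[of _ "\<lambda>i::nat. if i = 0 then U0 else U1"] conjI allI impI ballI)
    show "\<exists>i\<le>1. closed_ball x n \<subseteq> (if i = (0::nat) then U0 else U1)" if "x \<in> M" for x
      using cover[OF that] by force
    fix i :: nat and x y
    assume "x \<in> (if i = 0 then U0 else U1)" "reachable n (if i = 0 then U0 else U1) x y"
    then show "\<delta> x y \<le> 72 * (189 * A * A + 1) * n"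
      using comp0[of x y] comp1[of x y] unfolding K_def by (cases "i = 0") simp_all
  qed (use sub in auto)
qed

end

section \<open>Word metrics\<close>

text \<open>Lets a path follow a word letter by letter when a group is shown to be connected at
  scale 2.\<close>

lemma same_r_component_step:
  assumes "same_r_component d r Y x y" "z \<in> Y" "d y z < r"
  shows "same_r_component d r Y x z"
proof -
  obtain ps where ps: "ps \<noteq> []" "hd ps = x" "last ps = y" "set ps \<subseteq> Y"
    "\<And>j. Suc j < length ps \<Longrightarrow> d (ps ! j) (ps ! Suc j) < r"
    using assms(1) unfolding same_r_component_def by blast
  have "d ((ps @ [z]) ! j) ((ps @ [z]) ! Suc j) < r" if "Suc j < length (ps @ [z])" for j
  proof (cases "Suc j < length ps")
    case True
    then show ?thesis using ps(5)[of j] by (simp add: nth_append)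
  next
    case False
    with that have "j = length ps - 1" "Suc j = length ps" using ps(1) by auto
    with ps(1,3) assms(3) show ?thesis by (simp add: nth_append last_conv_nth)
  qed
  with ps assms(2) show ?thesis unfolding same_r_component_def
    by (intro exI[of _ "ps @ [z]"]) auto
qed

section \<open>Words over a generating set\<close>

locale gens_group = group G for G (structure) +
  fixes S
  assumes gens_closed: "S \<subseteq> carrier G"
begin

abbreviation letters where "letters \<equiv> S \<union> (\<lambda>s. inv s) ` S"

abbreviation wprod where "wprod ws \<equiv> foldr (\<lambda>a b. a \<otimes> b) ws \<one>"

abbreviation wl where "wl \<equiv> word_length G S"

lemma letters_closed: "letters \<subseteq> carrier G"
  using gens_closed by auto

lemma wprod_closed: "set ws \<subseteq> letters \<Longrightarrow> wprod ws \<in> carrier G"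
proof (induction ws)
  case (Cons a ws)
  then have "a \<in> carrier G" "wprod ws \<in> carrier G" using letters_closed by auto
  then show ?case by simp
qed simp

lemma wprod_append:
  "set us \<subseteq> letters \<Longrightarrow> set vs \<subseteq> letters \<Longrightarrow> wprod (us @ vs) = wprod us \<otimes> wprod vs"
proof (induction us)
  case Nil
  then show ?case using wprod_closed[of vs] by simp
next
  case (Cons u us)
  then have "u \<in> carrier G" using letters_closed by auto
  with Cons show ?case using wprod_closed[of us] wprod_closed[of vs] by (simp add: m_assoc)
qed

lemma inv_letter: "s \<in> letters \<Longrightarrow> inv s \<in> letters"
  using gens_closed by auto

lemma wl_le: "set ws \<subseteq> letters \<Longrightarrow> wl (wprod ws) \<le> length ws"
  unfolding word_length_def by (rule Least_le) auto

end

text \<open>Generation is kept apart from \<open>gens_group\<close> because for the wreath product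
  it is itself proved by constructing words, which needs the calculus of \<open>wprod\<close>
  beforehand.\<close>

locale word_group = gens_group +
  assumes word_exists: "x \<in> carrier G \<Longrightarrow> \<exists>ws. set ws \<subseteq> letters \<and> wprod ws = x"
begin

definition wdist where "wdist x y = wl (inv x \<otimes> y)"

definition wball where "wball n = {x \<in> carrier G. wl x \<le> n}"

lemma wl_word:
  assumes "x \<in> carrier G"
  obtains ws where "set ws \<subseteq> letters" "wprod ws = x" "length ws = wl x"
proof -
  have "\<exists>n ws. length ws = n \<and> set ws \<subseteq> letters \<and> wprod ws = x"
    using word_exists[OF assms] by blast
  from LeastI_ex[OF this] that show thesis unfolding word_length_def by blast
qed

lemma wl_one: "wl \<one> = 0"
  using wl_le[of "[]"] by simp

lemma wl_eq_0:
  assumes "x \<in> carrier G" "wl x = 0"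
  shows "x = \<one>"
proof -
  obtain ws where "wprod ws = x" "length ws = wl x" using wl_word[OF assms(1)] .
  with assms(2) show ?thesis by simp
qed

lemma wl_letter: "s \<in> letters \<Longrightarrow> wl s \<le> 1"
  using wl_le[of "[s]"] letters_closed by auto

lemma wl_mult:
  assumes "x \<in> carrier G" "y \<in> carrier G"
  shows "wl (x \<otimes> y) \<le> wl x + wl y"
proof -
  obtain us where us: "set us \<subseteq> letters" "wprod us = x" "length us = wl x"
    using wl_word[OF assms(1)] .
  obtain vs where vs: "set vs \<subseteq> letters" "wprod vs = y" "length vs = wl y"
    using wl_word[OF assms(2)] .
  show ?thesis
    using wl_le[of "us @ vs"] us vs wprod_append[of us vs] by simp
qed

text \<open>Stated for words rather than elements so that induction over the letters applies:
  inversion reverses the word and inverts each letter.\<close>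

lemma wl_inv_le: "set ws \<subseteq> letters \<Longrightarrow> wl (inv (wprod ws)) \<le> length ws"
proof (induction ws)
  case Nil
  then show ?case by (simp add: wl_one)
next
  case (Cons w ws)
  then have w: "w \<in> letters" "w \<in> carrier G" using letters_closed by auto
  have p: "wprod ws \<in> carrier G" using Cons wprod_closed[of ws] by simp
  have "wl (inv (wprod (w # ws))) = wl (inv (wprod ws) \<otimes> inv w)"
    using w p by (simp add: inv_mult_group)
  also have "\<dots> \<le> wl (inv (wprod ws)) + wl (inv w)"
    using w p by (intro wl_mult) auto
  also have "\<dots> \<le> length ws + 1"
    using Cons wl_letter[OF inv_letter[OF w(1)]] by (intro add_mono) auto
  finally show ?case by simp
qed

lemma wl_inv:
  assumes "x \<in> carrier G"
  shows "wl (inv x) = wl x"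
proof -
  have *: "wl (inv y) \<le> wl y" if "y \<in> carrier G" for y
    using wl_word[OF that] wl_inv_le by metis
  show ?thesis using *[OF assms] *[of "inv x"] assms by simp
qed

text \<open>Dropping the last letter of a shortest word for \<open>x\<close> leaves length exactly
  \<open>n\<close>, as a shorter \<open>y\<close> would shorten \<open>x\<close>. This provides
  parents in the Cayley graph.\<close>

lemma wl_parent:
  assumes "x \<in> carrier G" "wl x = Suc n"
  obtains y s where "y \<in> carrier G" "s \<in> letters" "x = y \<otimes> s" "wl y = n"
proof -
  obtain ws where ws: "set ws \<subseteq> letters" "wprod ws = x" "length ws = wl x"
    using wl_word[OF assms(1)] .
  then obtain us s where us: "ws = us @ [s]"
    using assms(2) by (metis length_0_conv nat.simps(3) rev_exhaust)
  have u: "set us \<subseteq> letters" "s \<in> letters" using ws us by auto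
  have cl: "wprod us \<in> carrier G" "s \<in> carrier G"
    using u letters_closed wprod_closed[OF u(1)] by auto
  have x: "x = wprod us \<otimes> s"
    using ws(2) wprod_append[of us "[s]"] u us cl by simp
  have "wl x \<le> wl (wprod us) + wl s" unfolding x by (rule wl_mult[OF cl])
  with wl_letter[OF u(2)] wl_le[OF u(1)] ws us assms(2) have "wl (wprod us) = n" by simp
  with that x u cl show thesis by blast
qed

section \<open>Balls: finiteness, tree structure, lower bound on size\<close>

lemma wball_0: "wball 0 = {\<one>}"
  unfolding wball_def using wl_eq_0 wl_one by auto

lemma finite_wball:
  assumes "finite S"
  shows "finite (wball n)"
proof (rule finite_subset)
  show "wball n \<subseteq> wprod ` {ws. set ws \<subseteq> letters \<and> length ws \<le> n}"
  proof
    fix x assume "x \<in> wball n"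
    then have x: "x \<in> carrier G" "wl x \<le> n" by (auto simp: wball_def)
    obtain ws where "set ws \<subseteq> letters" "wprod ws = x" "length ws = wl x"
      using wl_word[OF x(1)] .
    with x(2) show "x \<in> wprod ` {ws. set ws \<subseteq> letters \<and> length ws \<le> n}" by auto
  qed
  show "finite (wprod ` {ws. set ws \<subseteq> letters \<and> length ws \<le> n})"
    using assms by (intro finite_imageI finite_lists_length_le) auto
qed

text \<open>A derivation grows a finite tree in the Cayley graph, attaching each new vertex to an
  earlier one. Only the vertex set is kept; the edges reappear in the induction that builds
  tours.\<close>

inductive rooted_subtree where
  root: "rooted_subtree {\<one>}"
| leaf: "rooted_subtree T \<Longrightarrow> y \<in> T \<Longrightarrow> s \<in> letters \<Longrightarrow> y \<otimes> s \<notin> T \<Longrightarrow>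
    rooted_subtree (insert (y \<otimes> s) T)"

lemma rooted_subtree_finite_closed:
  assumes "rooted_subtree T"
  shows "finite T \<and> T \<subseteq> carrier G"
  using assms
proof induction
  case (leaf T y s)
  then have "y \<otimes> s \<in> carrier G" using letters_closed by (intro m_closed) auto
  with leaf show ?case by simp
qed simp

text \<open>The sphere of radius \<open>n + 1\<close> is attached to the ball of radius
  \<open>n\<close> one point at a time; each point has its parent already in the ball.\<close>

lemma rooted_subtree_wball:
  assumes "finite S"
  shows "rooted_subtree (wball n)"
proof (induction n)
  case 0
  then show ?case by (simp add: wball_0 root)
next
  case (Suc n)
  have *: "rooted_subtree (wball n \<union> F)" if "finite F" "F \<subseteq> {x \<in> carrier G. wl x = Suc n}" for F
    using that
  proof (induction F rule: finite_induct)
    case empty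
    then show ?case using Suc by simp
  next
    case (insert x F)
    then have x: "x \<in> carrier G" "wl x = Suc n" by auto
    obtain y s where y: "y \<in> carrier G" "s \<in> letters" "x = y \<otimes> s" "wl y = n"
      using wl_parent[OF x] by blast
    have "rooted_subtree (insert (y \<otimes> s) (wball n \<union> F))"
    proof (rule leaf)
      show "rooted_subtree (wball n \<union> F)" using insert by blast
      show "y \<in> wball n \<union> F" using y by (simp add: wball_def)
      show "y \<otimes> s \<notin> wball n \<union> F" using x insert(2) y(3) by (auto simp: wball_def)
    qed (rule y(2))
    then show ?case using y(3) by simp
  qed
  let ?F = "{x \<in> carrier G. wl x = Suc n}"
  have "wball (Suc n) = wball n \<union> ?F" by (auto simp: wball_def)
  moreover have "finite ?F"
    by (rule finite_subset[OF _ finite_wball[OF assms, of "Suc n"]]) (auto simp: wball_def)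
  ultimately show ?case using *[of ?F] by simp
qed

text \<open>Balls are finite, so an infinite group has an element longer than \<open>n\<close>. Its
  iterated parents realize every smaller length, so the ball contains elements of all lengths below
  \<open>n\<close>.\<close>

lemma card_wball_ge:
  assumes "finite S" "infinite (carrier G)"
  shows "n \<le> card (wball n)"
proof -
  have "\<not> carrier G \<subseteq> wball n"
    using finite_wball[OF assms(1)] assms(2) finite_subset by blast
  then obtain g where g: "g \<in> carrier G" "wl g > n" by (force simp: wball_def)
  \<comment> \<open>\<open>k\<close> counts how often a parent has been taken, starting from
    \<open>g\<close>.\<close>
  have ex: "\<exists>h\<in>carrier G. wl h + k = wl g" if "k \<le> wl g" for k
    using that
  proof (induction k)
    case 0
    then show ?case using g by auto
  next
    case (Suc k)
    then obtain h where h: "h \<in> carrier G" "wl h + k = wl g" by auto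
    with Suc.prems obtain m where m: "wl h = Suc m" by (cases "wl h") auto
    obtain y s where "y \<in> carrier G" "wl y = m" using wl_parent[OF h(1) m] by blast
    then show ?case using h m by auto
  qed
  have "{..<n} \<subseteq> wl ` wball n"
  proof
    fix k assume "k \<in> {..<n}"
    with ex[of "wl g - k"] g obtain h where "h \<in> carrier G" "wl h = k" by auto
    with \<open>k \<in> {..<n}\<close> show "k \<in> wl ` wball n" by (auto simp: wball_def)
  qed
  from surj_card_le[OF finite_wball[OF assms(1)] this] show ?thesis by simp
qed

section \<open>The word metric: homogeneity, coarse connectedness, linear growth\<close>

lemma wdist_refl: "x \<in> carrier G \<Longrightarrow> wdist x x = 0"
  by (simp add: wdist_def wl_one)

lemma wdist_sym:
  assumes "x \<in> carrier G" "y \<in> carrier G"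
  shows "wdist x y = wdist y x"
  using wl_inv[of "inv x \<otimes> y"] assms by (simp add: wdist_def inv_mult_group)

lemma inv_mult_split:
  assumes "x \<in> carrier G" "y \<in> carrier G" "z \<in> carrier G"
  shows "inv x \<otimes> z = (inv x \<otimes> y) \<otimes> (inv y \<otimes> z)"
proof -
  have "y \<otimes> (inv y \<otimes> z) = z"
    using assms by (simp add: m_assoc[symmetric])
  then show ?thesis using assms by (simp add: m_assoc)
qed

lemma wdist_triangle:
  assumes "x \<in> carrier G" "y \<in> carrier G" "z \<in> carrier G"
  shows "wdist x z \<le> wdist x y + wdist y z"
  using wl_mult[of "inv x \<otimes> y" "inv y \<otimes> z"] inv_mult_split[OF assms] assms
  by (simp add: wdist_def)

lemma word_dist_eq: "word_dist G S x y = real (wdist x y)"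
  by (simp add: word_dist_def wdist_def)

text \<open>Left translations are isometries, so estimates for balls about the identity hold about
  every point.\<close>

lemma wdist_ball_eq:
  assumes "x \<in> carrier G"
  shows "{y \<in> carrier G. wdist x y \<le> n} = (\<lambda>z. x \<otimes> z) ` wball n"
proof (intro equalityI subsetI)
  fix y assume "y \<in> {y \<in> carrier G. wdist x y \<le> n}"
  then have "y \<in> carrier G" "inv x \<otimes> y \<in> wball n" using assms by (auto simp: wball_def wdist_def)
  moreover have "y = x \<otimes> (inv x \<otimes> y)" using assms \<open>y \<in> carrier G\<close> by (simp add: m_assoc[symmetric])
  ultimately show "y \<in> (\<lambda>z. x \<otimes> z) ` wball n" by blast
next
  fix y assume "y \<in> (\<lambda>z. x \<otimes> z) ` wball n"
  then obtain z where "z \<in> carrier G" "wl z \<le> n" "y = x \<otimes> z" by (auto simp: wball_def)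
  then show "y \<in> {y \<in> carrier G. wdist x y \<le> n}"
    using assms by (simp add: wdist_def m_assoc[symmetric])
qed

lemma card_wdist_ball:
  assumes "x \<in> carrier G"
  shows "card {y \<in> carrier G. wdist x y \<le> n} = card (wball n)"
  unfolding wdist_ball_eq[OF assms]
  by (rule card_image) (use assms in \<open>auto simp: inj_on_def wball_def\<close>)

lemma finite_wdist_ball:
  assumes "finite S" "x \<in> carrier G"
  shows "finite {y \<in> carrier G. wdist x y \<le> n}"
  unfolding wdist_ball_eq[OF assms(2)] using finite_wball[OF assms(1)] by blast

text \<open>In dimension 0 the only set of the cover is the whole group. Successive prefixes of a
  word are at distance at most 1, so at scale 2 the group is a single component. A bound on its
  diameter would make the group a finite ball.\<close>

lemma not_has_linear_control_0:
  assumes "finite S" "infinite (carrier G)"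
  shows "\<not> has_linear_control (carrier G) (word_dist G S) 0"
proof
  assume "has_linear_control (carrier G) (word_dist G S) 0"
  then obtain C where C: "control_function (carrier G) (word_dist G S) 0 (\<lambda>r. C * r)"
    unfolding has_linear_control_def by blast
  obtain U where U: "carrier G = (\<Union>i\<le>(0::nat). U i)"
    "\<forall>x y. same_r_component (word_dist G S) 2 (U 0) x y \<longrightarrow> word_dist G S x y \<le> C * 2"
    using C[unfolded control_function_def, rule_format, of 2] by auto
  have U0: "U 0 = carrier G" using U(1) by simp
  have conn: "same_r_component (word_dist G S) 2 (carrier G) \<one> (wprod ws)"
    if "set ws \<subseteq> letters" for ws
    using that
  proof (induction ws rule: rev_induct)
    case Nil
    show ?case unfolding same_r_component_def by (intro exI[of _ "[\<one>]"]) auto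
  next
    case (snoc s ws)
    then have s: "s \<in> letters" "s \<in> carrier G" "wprod ws \<in> carrier G" "set ws \<subseteq> letters"
      using letters_closed wprod_closed[of ws] by auto
    have e: "wprod (ws @ [s]) = wprod ws \<otimes> s"
      using wprod_append[of ws "[s]"] s by simp
    show ?case unfolding e
    proof (rule same_r_component_step)
      show "same_r_component (word_dist G S) 2 (carrier G) \<one> (wprod ws)" using snoc s by blast
      show "word_dist G S (wprod ws) (wprod ws \<otimes> s) < 2"
        using wl_letter[OF s(1)] s by (simp add: word_dist_def m_assoc[symmetric])
    qed (use s in auto)
  qed
  have "wl x \<le> nat \<lceil>C * 2\<rceil>" if "x \<in> carrier G" for x
  proof -
    obtain ws where "set ws \<subseteq> letters" "wprod ws = x" using word_exists \<open>x \<in> carrier G\<close> by blast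
    with conn U U0 have "word_dist G S \<one> x \<le> C * 2" by metis
    then show ?thesis using that by (simp add: word_dist_def) linarith
  qed
  then have "carrier G \<subseteq> wball (nat \<lceil>C * 2\<rceil>)"
    unfolding wball_def by blast
  then show False using finite_wball[OF assms(1)] assms(2) finite_subset by blast
qed

text \<open>The closed ball of radius \<open>n\<close> is the open ball of radius
  \<open>n + 1\<close>. For \<open>n \<ge> 1\<close> the inequalities
  \<open>n + 1 \<le> 2 * n\<close> and \<open>1 \<le> n\<close> absorb the affine bound into a
  multiple of \<open>n\<close>; absolute values appear because \<open>a\<close> and \<open>b\<close>
  may be negative.\<close>

lemma linear_growth_card_wball:
  assumes "linear_growth G S"
  obtains A where "\<And>n. 1 \<le> n \<Longrightarrow> card (wball n) \<le> A * n"
proof -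
  obtain a b where ab: "\<And>r. r > 0 \<Longrightarrow> real (growth G S r) \<le> a * r + b"
    using assms unfolding linear_growth_def by blast
  define A where "A = nat \<lceil>2 * \<bar>a\<bar> + \<bar>b\<bar>\<rceil>"
  have A: "2 * \<bar>a\<bar> + \<bar>b\<bar> \<le> real A" unfolding A_def by linarith
  have "card (wball n) \<le> A * n" if n: "1 \<le> n" for n
  proof -
    have "wball n = {g \<in> carrier G. real (wl g) < real n + 1}" unfolding wball_def by force
    then have "real (card (wball n)) \<le> a * (real n + 1) + b"
      using ab[of "real n + 1"] by (simp add: growth_def)
    also have "\<dots> \<le> \<bar>a\<bar> * (2 * real n) + \<bar>b\<bar> * real n"
    proof (rule add_mono)
      have "a * (real n + 1) \<le> \<bar>a\<bar> * (real n + 1)" by (intro mult_right_mono) auto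
      also have "\<dots> \<le> \<bar>a\<bar> * (2 * real n)" using n by (intro mult_left_mono) auto
      finally show "a * (real n + 1) \<le> \<bar>a\<bar> * (2 * real n)" .
      have "\<bar>b\<bar> * 1 \<le> \<bar>b\<bar> * real n" using n by (intro mult_left_mono) auto
      then show "b \<le> \<bar>b\<bar> * real n" by linarith
    qed
    also have "\<dots> = (2 * \<bar>a\<bar> + \<bar>b\<bar>) * real n" by (simp add: algebra_simps)
    also have "\<dots> \<le> real A * real n" using A by (intro mult_right_mono) auto
    finally show ?thesis by (simp flip: of_nat_mult)
  qed
  with that show thesis by blast
qed

end

lemma (in gens_group) word_group_generate:
  assumes "generate G S = carrier G"
  shows "word_group G S"
proof -
  have "\<exists>ws. set ws \<subseteq> letters \<and> wprod ws = x" if "x \<in> generate G S" for x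
    using that
  proof (induction rule: generate.induct)
    case one
    show ?case by (intro exI[of _ "[]"]) simp
  next
    case (incl h)
    then show ?case using gens_closed by (intro exI[of _ "[h]"]) auto
  next
    case (inv h)
    then show ?case using gens_closed by (intro exI[of _ "[inv h]"]) auto
  next
    case (eng h1 h2)
    then obtain us vs where
      "set us \<subseteq> letters" "wprod us = h1" "set vs \<subseteq> letters" "wprod vs = h2" by blast
    then show ?case using wprod_append[of us vs] by (intro exI[of _ "us @ vs"]) auto
  qed
  then show ?thesis using assms by unfold_locales blast
qed

sublocale word_group \<subseteq> nat_metric "carrier G" wdist
  by unfold_locales (auto intro: wdist_refl wdist_sym wdist_triangle)

lemma (in word_group) linear_growth_nat_control:
  assumes "finite S" "infinite (carrier G)" "linear_growth G S"
  shows "\<exists>C. nat_control 1 C"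
proof -
  obtain A where A: "\<And>n. 1 \<le> n \<Longrightarrow> card (wball n) \<le> A * n"
    using linear_growth_card_wball[OF assms(3)] by blast
  interpret linear_growth_metric "carrier G" wdist A
    by unfold_locales
      (simp_all add: finite_wdist_ball card_wdist_ball assms(1) card_wball_ge[OF assms(1,2)] A)
  show ?thesis using linear_growth_control by blast
qed

section \<open>The wreath product\<close>

lemma wreath_simps:
  "carrier (wreath H G) = wr_carrier H G"
  "x \<otimes>\<^bsub>wreath H G\<^esub> y = wr_mult H G x y"
  "\<one>\<^bsub>wreath H G\<^esub> = (\<lambda>_. \<one>\<^bsub>H\<^esub>, \<one>\<^bsub>G\<^esub>)"
  by (simp_all add: wreath_def)

lemma snd_wr_mult: "snd (wr_mult H G x y) = snd x \<otimes>\<^bsub>G\<^esub> snd y"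
  by (simp add: wr_mult_def)

lemma fst_wr_mult: "\<gamma> \<in> carrier G \<Longrightarrow>
  fst (wr_mult H G x y) \<gamma> = fst x \<gamma> \<otimes>\<^bsub>H\<^esub> fst y (inv\<^bsub>G\<^esub> (snd x) \<otimes>\<^bsub>G\<^esub> \<gamma>)"
  by (simp add: wr_mult_def)

lemma fst_wr_mult_outside: "\<gamma> \<notin> carrier G \<Longrightarrow> fst (wr_mult H G x y) \<gamma> = \<one>\<^bsub>H\<^esub>"
  by (simp add: wr_mult_def)

lemma wr_carrier_iff:
  "x \<in> wr_carrier H G \<longleftrightarrow> (\<forall>\<gamma>\<in>carrier G. fst x \<gamma> \<in> carrier H) \<and>
     (\<forall>\<gamma>. \<gamma> \<notin> carrier G \<longrightarrow> fst x \<gamma> = \<one>\<^bsub>H\<^esub>) \<and>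
     finite {\<gamma> \<in> carrier G. fst x \<gamma> \<noteq> \<one>\<^bsub>H\<^esub>} \<and> snd x \<in> carrier G"
  by (cases x) (simp add: wr_carrier_def)

text \<open>Lamp functions are trivial outside the carrier of \<open>G\<close>, so comparing them on
  the carrier suffices.\<close>

lemma wr_eqI:
  assumes "x \<in> wr_carrier H G" "y \<in> wr_carrier H G" "snd x = snd y"
    "\<And>\<gamma>. \<gamma> \<in> carrier G \<Longrightarrow> fst x \<gamma> = fst y \<gamma>"
  shows "x = y"
proof (rule prod_eqI)
  show "fst x = fst y"
  proof
    fix \<gamma> show "fst x \<gamma> = fst y \<gamma>"
      using assms by (cases "\<gamma> \<in> carrier G") (auto simp: wr_carrier_iff)
  qed
qed (rule assms(3))

text \<open>The support of the product lies in the union of the support of \<open>x\<close> and the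
  translate by \<open>snd x\<close> of the support of \<open>y\<close>, hence is finite.\<close>

lemma wr_mult_closed:
  assumes "group G" "group H" and x: "x \<in> wr_carrier H G" and y: "y \<in> wr_carrier H G"
  shows "wr_mult H G x y \<in> wr_carrier H G"
proof -
  interpret G: group G by fact
  interpret H: group H by fact
  let ?supp = "\<lambda>x. {\<gamma> \<in> carrier G. fst x \<gamma> \<noteq> \<one>\<^bsub>H\<^esub>}"
  have "?supp (wr_mult H G x y) \<subseteq> ?supp x \<union> (\<lambda>\<gamma>. snd x \<otimes>\<^bsub>G\<^esub> \<gamma>) ` ?supp y"
  proof
    fix \<gamma> assume \<gamma>: "\<gamma> \<in> ?supp (wr_mult H G x y)"
    then have c: "\<gamma> \<in> carrier G" "snd x \<in> carrier G" using x by (auto simp: wr_carrier_iff)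
    then have e: "snd x \<otimes>\<^bsub>G\<^esub> (inv\<^bsub>G\<^esub> (snd x) \<otimes>\<^bsub>G\<^esub> \<gamma>) = \<gamma>"
      by (simp add: G.m_assoc[symmetric])
    show "\<gamma> \<in> ?supp x \<union> (\<lambda>\<gamma>. snd x \<otimes>\<^bsub>G\<^esub> \<gamma>) ` ?supp y"
    proof (cases "fst x \<gamma> = \<one>\<^bsub>H\<^esub>")
      case True
      then have "inv\<^bsub>G\<^esub> (snd x) \<otimes>\<^bsub>G\<^esub> \<gamma> \<in> ?supp y" using \<gamma> c by (auto simp: fst_wr_mult)
      then show ?thesis using e by (intro UnI2) (metis (no_types, lifting) imageI)
    qed (use c in auto)
  qed
  moreover have "finite (?supp x \<union> (\<lambda>\<gamma>. snd x \<otimes>\<^bsub>G\<^esub> \<gamma>) ` ?supp y)"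
    using x y by (auto simp: wr_carrier_iff)
  ultimately have "finite (?supp (wr_mult H G x y))" by (rule finite_subset)
  then show ?thesis using x y unfolding wr_carrier_iff[of "wr_mult H G x y"]
    by (auto simp: wr_carrier_iff fst_wr_mult fst_wr_mult_outside snd_wr_mult)
qed

lemma group_wreath:
  assumes "group G" "group H"
  shows "group (wreath H G)"
proof -
  interpret G: group G by fact
  interpret H: group H by fact
  note closed = wr_mult_closed[OF assms]
  show ?thesis
  proof (rule groupI, unfold wreath_simps)
    show one: "(\<lambda>_. \<one>\<^bsub>H\<^esub>, \<one>\<^bsub>G\<^esub>) \<in> wr_carrier H G" by (simp add: wr_carrier_iff)
    fix x assume x: "x \<in> wr_carrier H G"
    show "wr_mult H G (\<lambda>_. \<one>\<^bsub>H\<^esub>, \<one>\<^bsub>G\<^esub>) x = x"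
    proof (rule wr_eqI[OF closed[OF one x] x])
      show "snd (wr_mult H G (\<lambda>_. \<one>\<^bsub>H\<^esub>, \<one>\<^bsub>G\<^esub>) x) = snd x"
        using x by (simp add: snd_wr_mult wr_carrier_iff)
    qed (use x in \<open>simp add: fst_wr_mult wr_carrier_iff\<close>)
    show "\<exists>y\<in>wr_carrier H G. wr_mult H G y x = (\<lambda>_. \<one>\<^bsub>H\<^esub>, \<one>\<^bsub>G\<^esub>)"
    proof
      \<comment> \<open>The left inverse of \<open>(f, b)\<close>: its lamp at
        \<open>\<gamma>\<close> is the inverse of \<open>f\<close> at \<open>b \<gamma>\<close>, so
        its support is the support of \<open>f\<close> translated by the inverse of
        \<open>b\<close>.\<close>
      define y where "y = ((\<lambda>\<gamma>. if \<gamma> \<in> carrier G then inv\<^bsub>H\<^esub> (fst x (snd x \<otimes>\<^bsub>G\<^esub> \<gamma>)) else \<one>\<^bsub>H\<^esub>),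
        inv\<^bsub>G\<^esub> (snd x))"
      have c: "snd x \<in> carrier G" using x by (simp add: wr_carrier_iff)
      have "{\<gamma> \<in> carrier G. fst y \<gamma> \<noteq> \<one>\<^bsub>H\<^esub>} \<subseteq>
          (\<lambda>\<gamma>. inv\<^bsub>G\<^esub> (snd x) \<otimes>\<^bsub>G\<^esub> \<gamma>) ` {\<gamma> \<in> carrier G. fst x \<gamma> \<noteq> \<one>\<^bsub>H\<^esub>}"
      proof
        fix \<gamma> assume \<gamma>: "\<gamma> \<in> {\<gamma> \<in> carrier G. fst y \<gamma> \<noteq> \<one>\<^bsub>H\<^esub>}"
        then have "snd x \<otimes>\<^bsub>G\<^esub> \<gamma> \<in> {\<gamma> \<in> carrier G. fst x \<gamma> \<noteq> \<one>\<^bsub>H\<^esub>}"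
          using c by (auto simp: y_def)
        moreover have "\<gamma> = inv\<^bsub>G\<^esub> (snd x) \<otimes>\<^bsub>G\<^esub> (snd x \<otimes>\<^bsub>G\<^esub> \<gamma>)"
          using \<gamma> c by (simp add: G.m_assoc[symmetric])
        ultimately show "\<gamma> \<in> (\<lambda>\<gamma>. inv\<^bsub>G\<^esub> (snd x) \<otimes>\<^bsub>G\<^esub> \<gamma>) ` {\<gamma> \<in> carrier G. fst x \<gamma> \<noteq> \<one>\<^bsub>H\<^esub>}"
          by (rule rev_image_eqI)
      qed
      then have "finite {\<gamma> \<in> carrier G. fst y \<gamma> \<noteq> \<one>\<^bsub>H\<^esub>}"
        using x finite_subset by (auto simp: wr_carrier_iff)
      then show y: "y \<in> wr_carrier H G"
        using x c unfolding wr_carrier_iff[of y] by (auto simp: y_def wr_carrier_iff)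
      show "wr_mult H G y x = (\<lambda>_. \<one>\<^bsub>H\<^esub>, \<one>\<^bsub>G\<^esub>)"
      proof (rule wr_eqI[OF closed[OF y x] one])
        show "snd (wr_mult H G y x) = snd (\<lambda>_. \<one>\<^bsub>H\<^esub>, \<one>\<^bsub>G\<^esub>)"
          using c by (simp add: snd_wr_mult y_def)
      qed (use x c in \<open>simp add: fst_wr_mult y_def wr_carrier_iff\<close>)
    qed
    fix y assume y: "y \<in> wr_carrier H G"
    show "wr_mult H G x y \<in> wr_carrier H G" by (rule closed[OF x y])
    fix z assume z: "z \<in> wr_carrier H G"
    show "wr_mult H G (wr_mult H G x y) z = wr_mult H G x (wr_mult H G y z)"
    proof (rule wr_eqI[OF closed[OF closed[OF x y] z] closed[OF x closed[OF y z]]])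
      have c: "snd x \<in> carrier G" "snd y \<in> carrier G" "snd z \<in> carrier G"
        using x y z by (auto simp: wr_carrier_iff)
      show "snd (wr_mult H G (wr_mult H G x y) z) = snd (wr_mult H G x (wr_mult H G y z))"
        using c by (simp add: snd_wr_mult G.m_assoc)
      fix \<gamma> assume "\<gamma> \<in> carrier G"
      then show "fst (wr_mult H G (wr_mult H G x y) z) \<gamma> = fst (wr_mult H G x (wr_mult H G y z)) \<gamma>"
        using x y z c
        by (simp add: fst_wr_mult snd_wr_mult wr_carrier_iff H.m_assoc G.inv_mult_group G.m_assoc)
    qed
  qed
qed

section \<open>Words in the wreath product and lamp tours\<close>

locale wreath_word_group = G: word_group G S + H: group H
  for G :: "('g, 'd) monoid_scheme" and S :: "'g set" and H :: "('h, 'c) monoid_scheme" +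
  assumes finite_gens: "finite S"
begin

abbreviation W where "W \<equiv> wreath H G"

lemma embH_closed: "h \<in> carrier H \<Longrightarrow> wr_embH H G h \<in> carrier W"
  unfolding wreath_simps
proof -
  assume h: "h \<in> carrier H"
  have "{\<gamma> \<in> carrier G. fst (wr_embH H G h) \<gamma> \<noteq> \<one>\<^bsub>H\<^esub>} \<subseteq> {\<one>\<^bsub>G\<^esub>}" by (auto simp: wr_embH_def)
  then have "finite {\<gamma> \<in> carrier G. fst (wr_embH H G h) \<gamma> \<noteq> \<one>\<^bsub>H\<^esub>}"
    using finite_subset by blast
  with h show "wr_embH H G h \<in> wr_carrier H G" unfolding wr_carrier_iff by (auto simp: wr_embH_def)
qed

lemma embG_closed: "g \<in> carrier G \<Longrightarrow> wr_embG H G g \<in> carrier W"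
  by (simp add: wreath_simps wr_carrier_iff wr_embG_def)

sublocale W: gens_group W "wr_gens H G S"
proof -
  interpret group W by (rule group_wreath) unfold_locales
  show "gens_group W (wr_gens H G S)"
    by unfold_locales (use embH_closed embG_closed G.gens_closed in \<open>auto simp: wr_gens_def\<close>)
qed

lemma inv_embH:
  assumes "h \<in> carrier H"
  shows "inv\<^bsub>W\<^esub> (wr_embH H G h) = wr_embH H G (inv\<^bsub>H\<^esub> h)"
proof (rule W.inv_equality)
  show "wr_embH H G (inv\<^bsub>H\<^esub> h) \<otimes>\<^bsub>W\<^esub> wr_embH H G h = \<one>\<^bsub>W\<^esub>"
    using assms by (auto simp: wreath_simps wr_mult_def wr_embH_def fun_eq_iff)
qed (use assms embH_closed in auto)

lemma inv_embG:
  assumes "g \<in> carrier G"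
  shows "inv\<^bsub>W\<^esub> (wr_embG H G g) = wr_embG H G (inv\<^bsub>G\<^esub> g)"
proof (rule W.inv_equality)
  show "wr_embG H G (inv\<^bsub>G\<^esub> g) \<otimes>\<^bsub>W\<^esub> wr_embG H G g = \<one>\<^bsub>W\<^esub>"
    using assms by (auto simp: wreath_simps wr_mult_def wr_embG_def fun_eq_iff)
qed (use assms embG_closed in auto)

text \<open>Inverses of lamp letters are again lamp letters. So a letter appended to a word either
  changes the lamp at the cursor or moves the cursor by a letter of \<open>G\<close>.\<close>

lemma letters_eq:
  "W.letters = wr_embH H G ` (carrier H - {\<one>\<^bsub>H\<^esub>}) \<union> wr_embG H G ` G.letters"
proof -
  have G: "(\<lambda>x. inv\<^bsub>W\<^esub> x) ` wr_embG H G ` S = wr_embG H G ` (\<lambda>s. inv\<^bsub>G\<^esub> s) ` S"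
    unfolding image_image using G.gens_closed by (intro image_cong refl inv_embG) auto
  have H: "(\<lambda>x. inv\<^bsub>W\<^esub> x) ` wr_embH H G ` (carrier H - {\<one>\<^bsub>H\<^esub>}) \<subseteq>
      wr_embH H G ` (carrier H - {\<one>\<^bsub>H\<^esub>})"
    unfolding image_image
  proof (rule image_subsetI)
    fix h assume "h \<in> carrier H - {\<one>\<^bsub>H\<^esub>}"
    then show "inv\<^bsub>W\<^esub> (wr_embH H G h) \<in> wr_embH H G ` (carrier H - {\<one>\<^bsub>H\<^esub>})"
      by (intro rev_image_eqI[of "inv\<^bsub>H\<^esub> h"]) (simp_all add: inv_embH)
  qed
  \<comment> \<open>\<open>I\<close> stands for the inverses of the lamp letters, absorbed by
    \<open>A\<close>, and \<open>J\<close> for the inverses of the cursor moves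
    \<open>B\<close>.\<close>
  have "A \<union> B \<union> (I \<union> J) = A \<union> (B \<union> J)" if "I \<subseteq> A" for A B I J :: "(('g \<Rightarrow> 'h) \<times> 'g) set"
    using that by auto
  from this[OF H] show ?thesis unfolding wr_gens_def image_Un G .
qed

lemma fst_closed: "x \<in> carrier W \<Longrightarrow> \<gamma> \<in> carrier G \<Longrightarrow> fst x \<gamma> \<in> carrier H"
  by (simp add: wreath_simps wr_carrier_iff)

lemma snd_closed: "x \<in> carrier W \<Longrightarrow> snd x \<in> carrier G"
  by (simp add: wreath_simps wr_carrier_iff)

lemma snd_mult: "snd (x \<otimes>\<^bsub>W\<^esub> y) = snd x \<otimes>\<^bsub>G\<^esub> snd y"
  by (simp add: wreath_simps snd_wr_mult)

lemma fst_mult: "\<gamma> \<in> carrier G \<Longrightarrow>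
  fst (x \<otimes>\<^bsub>W\<^esub> y) \<gamma> = fst x \<gamma> \<otimes>\<^bsub>H\<^esub> fst y (inv\<^bsub>G\<^esub> (snd x) \<otimes>\<^bsub>G\<^esub> \<gamma>)"
  by (simp add: wreath_simps fst_wr_mult)

lemma snd_inv:
  assumes "x \<in> carrier W"
  shows "snd (inv\<^bsub>W\<^esub> x) = inv\<^bsub>G\<^esub> (snd x)"
proof -
  have "inv\<^bsub>W\<^esub> x \<otimes>\<^bsub>W\<^esub> x = \<one>\<^bsub>W\<^esub>" using assms by simp
  then have "snd (inv\<^bsub>W\<^esub> x \<otimes>\<^bsub>W\<^esub> x) = \<one>\<^bsub>G\<^esub>" by (simp only: wreath_simps(3) snd_conv)
  then have "snd (inv\<^bsub>W\<^esub> x) \<otimes>\<^bsub>G\<^esub> snd x = \<one>\<^bsub>G\<^esub>" by (simp only: snd_mult)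
  from G.inv_equality[OF this] assms show ?thesis by (simp add: snd_closed)
qed

text \<open>Induction on the front letter: a lamp letter affects only the lamp at the identity, and
  a cursor move translates the cursor and all lamps by one letter.\<close>

lemma word_support:
  assumes "set ws \<subseteq> W.letters"
  shows "G.wl (snd (W.wprod ws)) \<le> length ws"
    and "\<gamma> \<in> carrier G \<Longrightarrow> fst (W.wprod ws) \<gamma> \<noteq> \<one>\<^bsub>H\<^esub> \<Longrightarrow> G.wl \<gamma> \<le> length ws"
proof -
  have "G.wl (snd (W.wprod ws)) \<le> length ws \<and>
      (\<forall>\<gamma>\<in>carrier G. fst (W.wprod ws) \<gamma> \<noteq> \<one>\<^bsub>H\<^esub> \<longrightarrow> G.wl \<gamma> \<le> length ws)"
    using assms
  proof (induction ws)
    case Nil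
    then show ?case by (simp add: wreath_simps G.wl_one)
  next
    case (Cons w ws)
    define x where "x = W.wprod ws"
    have x: "x \<in> carrier W" using Cons.prems W.wprod_closed[of ws] by (simp add: x_def)
    have c: "snd x \<in> carrier G" "\<And>\<gamma>. \<gamma> \<in> carrier G \<Longrightarrow> fst x \<gamma> \<in> carrier H"
      using x snd_closed fst_closed by auto
    have IH: "G.wl (snd x) \<le> length ws"
      "\<And>\<gamma>. \<gamma> \<in> carrier G \<Longrightarrow> fst x \<gamma> \<noteq> \<one>\<^bsub>H\<^esub> \<Longrightarrow> G.wl \<gamma> \<le> length ws"
      using Cons by (auto simp: x_def)
    have e: "W.wprod (w # ws) = w \<otimes>\<^bsub>W\<^esub> x" by (simp add: x_def)
    have "w \<in> W.letters" using Cons.prems by simp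
    then consider h where "h \<in> carrier H" "w = wr_embH H G h"
      | s where "s \<in> G.letters" "w = wr_embG H G s"
      unfolding letters_eq by blast
    then show ?case
    proof cases
      case 1
      have "snd (w \<otimes>\<^bsub>W\<^esub> x) = snd x" using c 1 by (simp add: snd_mult wr_embH_def)
      moreover have "G.wl \<gamma> \<le> length ws"
        if "\<gamma> \<in> carrier G" "fst (w \<otimes>\<^bsub>W\<^esub> x) \<gamma> \<noteq> \<one>\<^bsub>H\<^esub>" for \<gamma>
        using that IH(2)[of \<gamma>] c 1
        by (cases "\<gamma> = \<one>\<^bsub>G\<^esub>") (auto simp: fst_mult wr_embH_def G.wl_one)
      ultimately show ?thesis unfolding e using IH(1) by fastforce
    next
      case 2
      have s: "s \<in> carrier G" "G.wl s \<le> 1" using 2 G.letters_closed G.wl_letter by auto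
      have "G.wl (snd (w \<otimes>\<^bsub>W\<^esub> x)) \<le> G.wl s + G.wl (snd x)"
        using G.wl_mult[OF s(1) c(1)] 2 by (simp add: snd_mult wr_embG_def)
      moreover have "G.wl \<gamma> \<le> length (w # ws)"
        if \<gamma>: "\<gamma> \<in> carrier G" "fst (w \<otimes>\<^bsub>W\<^esub> x) \<gamma> \<noteq> \<one>\<^bsub>H\<^esub>" for \<gamma>
      proof -
        have "fst x (inv\<^bsub>G\<^esub> s \<otimes>\<^bsub>G\<^esub> \<gamma>) \<noteq> \<one>\<^bsub>H\<^esub>"
          using \<gamma> s 2 by (auto simp: fst_mult wr_embG_def)
        then have "G.wl (inv\<^bsub>G\<^esub> s \<otimes>\<^bsub>G\<^esub> \<gamma>) \<le> length ws" using IH(2) \<gamma> s by simp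
        moreover have "G.wl (s \<otimes>\<^bsub>G\<^esub> (inv\<^bsub>G\<^esub> s \<otimes>\<^bsub>G\<^esub> \<gamma>)) \<le> G.wl s + G.wl (inv\<^bsub>G\<^esub> s \<otimes>\<^bsub>G\<^esub> \<gamma>)"
          using \<gamma> s by (intro G.wl_mult) auto
        moreover have "s \<otimes>\<^bsub>G\<^esub> (inv\<^bsub>G\<^esub> s \<otimes>\<^bsub>G\<^esub> \<gamma>) = \<gamma>"
          using \<gamma> s by (simp add: G.m_assoc[symmetric])
        ultimately show ?thesis using s(2) by simp
      qed
      ultimately show ?thesis unfolding e using IH(1) s(2) by auto
    qed
  qed
  then show "G.wl (snd (W.wprod ws)) \<le> length ws"
    "\<gamma> \<in> carrier G \<Longrightarrow> fst (W.wprod ws) \<gamma> \<noteq> \<one>\<^bsub>H\<^esub> \<Longrightarrow> G.wl \<gamma> \<le> length ws" by auto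
qed

lemma wprod_map_embG:
  "set ws \<subseteq> G.letters \<Longrightarrow> W.wprod (map (wr_embG H G) ws) = wr_embG H G (G.wprod ws)"
proof (induction ws)
  case Nil
  then show ?case by (simp add: wreath_simps wr_embG_def)
next
  case (Cons w ws)
  then have "W.wprod (map (wr_embG H G) (w # ws)) = wr_embG H G w \<otimes>\<^bsub>W\<^esub> wr_embG H G (G.wprod ws)"
    by simp
  also have "\<dots> = wr_embG H G (G.wprod (w # ws))"
    by (simp add: wreath_simps wr_mult_def wr_embG_def fun_eq_iff)
  finally show ?case .
qed

lemma embH_one: "wr_embH H G \<one>\<^bsub>H\<^esub> = \<one>\<^bsub>W\<^esub>"
  by (simp add: wreath_simps wr_embH_def)

text \<open>The word goes to \<open>s\<close>, sets the lamp there to \<open>h\<close> and returns.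
  For trivial \<open>h\<close> the lamp letter is omitted, since the identity is not a generator.
  The first letter is displayed separately because the prefix ending in it is the visit to the new
  leaf of a tour.\<close>

lemma lamp_word:
  assumes "s \<in> G.letters" "h \<in> carrier H"
  obtains ms where "set ms \<subseteq> W.letters" "length (wr_embG H G s # ms) \<le> 3"
    "snd (W.wprod (wr_embG H G s # ms)) = \<one>\<^bsub>G\<^esub>"
    "\<And>\<gamma>. \<gamma> \<in> carrier G \<Longrightarrow>
      fst (W.wprod (wr_embG H G s # ms)) \<gamma> = (if \<gamma> = s then h else \<one>\<^bsub>H\<^esub>)"
proof -
  let ?ms = "(if h = \<one>\<^bsub>H\<^esub> then [] else [wr_embH H G h]) @ [wr_embG H G (inv\<^bsub>G\<^esub> s)]"
  have s: "s \<in> carrier G" "inv\<^bsub>G\<^esub> s \<in> G.letters" "inv\<^bsub>G\<^esub> s \<in> carrier G"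
    using assms G.letters_closed G.inv_letter by auto
  have iff: "inv\<^bsub>G\<^esub> s \<otimes>\<^bsub>G\<^esub> \<gamma> = \<one>\<^bsub>G\<^esub> \<longleftrightarrow> \<gamma> = s" if "\<gamma> \<in> carrier G" for \<gamma>
    using that s by (metis G.inv_closed G.inv_inv G.l_inv G.inv_equality)
  have "W.wprod ?ms = wr_embH H G h \<otimes>\<^bsub>W\<^esub> wr_embG H G (inv\<^bsub>G\<^esub> s)"
    using embG_closed[OF s(3)] by (simp add: embH_one)
  then have prod: "W.wprod (wr_embG H G s # ?ms) =
      wr_embG H G s \<otimes>\<^bsub>W\<^esub> (wr_embH H G h \<otimes>\<^bsub>W\<^esub> wr_embG H G (inv\<^bsub>G\<^esub> s))"
    by simp
  show thesis
  proof (rule that[of ?ms])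
    show "set ?ms \<subseteq> W.letters" unfolding letters_eq using assms(2) s(2) by auto
    show "length (wr_embG H G s # ?ms) \<le> 3" by simp
    show "snd (W.wprod (wr_embG H G s # ?ms)) = \<one>\<^bsub>G\<^esub>"
      unfolding prod using s by (simp add: snd_mult wr_embG_def wr_embH_def)
    fix \<gamma> assume "\<gamma> \<in> carrier G"
    then show "fst (W.wprod (wr_embG H G s # ?ms)) \<gamma> = (if \<gamma> = s then h else \<one>\<^bsub>H\<^esub>)"
      unfolding prod using s assms(2) iff[of \<gamma>] by (simp add: fst_mult wr_embG_def wr_embH_def)
  qed
qed

text \<open>A depth-first tour of the tree: each new leaf \<open>y s\<close> is inserted into the tour at a visit
  to \<open>y\<close>, as a detour that sets the lamp at \<open>y s\<close> and returns.\<close>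

lemma tour_word:
  assumes "G.rooted_subtree T" "\<And>\<gamma>. f \<gamma> \<in> carrier H" "\<And>\<gamma>. \<gamma> \<notin> T \<Longrightarrow> f \<gamma> = \<one>\<^bsub>H\<^esub>"
  shows "\<exists>ws. set ws \<subseteq> W.letters \<and> length ws \<le> 3 * card T \<and> W.wprod ws = (f, \<one>\<^bsub>G\<^esub>) \<and>
    (\<forall>z\<in>T. \<exists>us vs. ws = us @ vs \<and> snd (W.wprod us) = z)"
  using assms
proof (induction arbitrary: f rule: G.rooted_subtree.induct)
  case root
  have f: "(f, \<one>\<^bsub>G\<^esub>) = wr_embH H G (f \<one>\<^bsub>G\<^esub>)"
    using root by (auto simp: wr_embH_def fun_eq_iff)
  let ?ws = "if f \<one>\<^bsub>G\<^esub> = \<one>\<^bsub>H\<^esub> then [] else [wr_embH H G (f \<one>\<^bsub>G\<^esub>)]"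
  have "set ?ws \<subseteq> W.letters" unfolding letters_eq using root by auto
  moreover have "W.wprod ?ws = (f, \<one>\<^bsub>G\<^esub>)"
    unfolding f using embH_closed[of "f \<one>\<^bsub>G\<^esub>"] root(1) by (simp add: embH_one)
  moreover have "\<exists>us vs. ?ws = us @ vs \<and> snd (W.wprod us) = z" if "z \<in> {\<one>\<^bsub>G\<^esub>}" for z
    using that by (intro exI[of _ "[]"] exI[of _ ?ws]) (simp add: wreath_simps)
  ultimately show ?case by (intro exI[of _ ?ws]) simp
next
  case (leaf T y s)
  define x where "x = y \<otimes>\<^bsub>G\<^esub> s"
  have T: "finite T" "T \<subseteq> carrier G" using G.rooted_subtree_finite_closed[OF leaf(1)] by auto
  have c: "y \<in> carrier G" "s \<in> carrier G" using T leaf(2,3) G.letters_closed by auto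
  then have c3: "x \<in> carrier G" by (simp add: x_def)
  have xT: "x \<notin> T" using leaf by (simp add: x_def)
  \<comment> \<open>With the lamp at the new leaf switched off, the induction hypothesis for
    \<open>T\<close> applies; the detour then supplies the missing lamp.\<close>
  define f' where "f' = f(x := \<one>\<^bsub>H\<^esub>)"
  have f': "f' \<gamma> \<in> carrier H" "\<gamma> \<notin> T \<Longrightarrow> f' \<gamma> = \<one>\<^bsub>H\<^esub>" for \<gamma>
    using leaf.prems by (auto simp: f'_def x_def)
  obtain ws where ws: "set ws \<subseteq> W.letters" "length ws \<le> 3 * card T" "W.wprod ws = (f', \<one>\<^bsub>G\<^esub>)"
    "\<forall>z\<in>T. \<exists>us vs. ws = us @ vs \<and> snd (W.wprod us) = z"
    using leaf.IH[of f', OF f'(1) f'(2)] by blast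
  obtain us vs where uv: "ws = us @ vs" "snd (W.wprod us) = y" using ws(4) leaf(2) by blast
  have let_uv: "set us \<subseteq> W.letters" "set vs \<subseteq> W.letters" using ws(1) uv(1) by auto
  define u where "u = W.wprod us"
  define v where "v = W.wprod vs"
  have uvc: "u \<in> carrier W" "v \<in> carrier W"
    using W.wprod_closed[OF let_uv(1)] W.wprod_closed[OF let_uv(2)] by (simp_all add: u_def v_def)
  have u: "snd u = y" using uv(2) by (simp add: u_def)
  have prod_uv: "u \<otimes>\<^bsub>W\<^esub> v = (f', \<one>\<^bsub>G\<^esub>)"
    using W.wprod_append[OF let_uv] ws(3) uv(1) by (simp add: u_def v_def)
  define a where "a = fst u x"
  have a: "a \<in> carrier H" using uvc c3 fst_closed by (simp add: a_def)
  have fx: "f x \<in> carrier H" using leaf.prems by blast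
  \<comment> \<open>At \<open>x\<close> the old tour yields \<open>a\<close> before the insertion
    point and the inverse of \<open>a\<close> after it, since \<open>f' x\<close> is trivial. The
    lamp set in between is therefore conjugated by \<open>a\<close>, which this choice of
    \<open>h\<close> undoes.\<close>
  define h where "h = inv\<^bsub>H\<^esub> a \<otimes>\<^bsub>H\<^esub> f x \<otimes>\<^bsub>H\<^esub> a"
  have h: "h \<in> carrier H" using a fx by (simp add: h_def)
  obtain ms where ms: "set ms \<subseteq> W.letters" "length (wr_embG H G s # ms) \<le> 3"
    "snd (W.wprod (wr_embG H G s # ms)) = \<one>\<^bsub>G\<^esub>"
    "\<And>\<gamma>. \<gamma> \<in> carrier G \<Longrightarrow>
      fst (W.wprod (wr_embG H G s # ms)) \<gamma> = (if \<gamma> = s then h else \<one>\<^bsub>H\<^esub>)"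
    using lamp_word[OF leaf(3) h] by blast
  define mid where "mid = wr_embG H G s # ms"
  have embs: "wr_embG H G s \<in> W.letters" unfolding letters_eq using leaf(3) by blast
  have mid: "set mid \<subseteq> W.letters" "length mid \<le> 3" "snd (W.wprod mid) = \<one>\<^bsub>G\<^esub>"
    "\<And>\<gamma>. \<gamma> \<in> carrier G \<Longrightarrow> fst (W.wprod mid) \<gamma> = (if \<gamma> = s then h else \<one>\<^bsub>H\<^esub>)"
    using ms embs by (auto simp: mid_def)
  have midc: "W.wprod mid \<in> carrier W" using W.wprod_closed[OF mid(1)] .
  let ?new = "us @ mid @ vs"
  have let_new: "set ?new \<subseteq> W.letters" using let_uv mid(1) by auto
  have prod_new: "W.wprod ?new = u \<otimes>\<^bsub>W\<^esub> (W.wprod mid \<otimes>\<^bsub>W\<^esub> v)"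
    using W.wprod_append[of us "mid @ vs"] W.wprod_append[of mid vs] let_uv mid(1)
    by (simp add: u_def v_def)
  have "W.wprod ?new = (f, \<one>\<^bsub>G\<^esub>)"
  proof (rule wr_eqI)
    show "W.wprod ?new \<in> wr_carrier H G"
      using W.wprod_closed[OF let_new] by (simp only: wreath_simps(1))
    have "{\<gamma> \<in> carrier G. f \<gamma> \<noteq> \<one>\<^bsub>H\<^esub>} \<subseteq> insert x T" using leaf.prems(2) by (auto simp: x_def)
    then have "finite {\<gamma> \<in> carrier G. f \<gamma> \<noteq> \<one>\<^bsub>H\<^esub>}" using T(1) finite_subset by blast
    moreover have "f \<gamma> = \<one>\<^bsub>H\<^esub>" if "\<gamma> \<notin> carrier G" for \<gamma>
      using that leaf.prems(2)[of \<gamma>] T(2) c3 by (auto simp: x_def)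
    ultimately show "(f, \<one>\<^bsub>G\<^esub>) \<in> wr_carrier H G"
      using leaf.prems(1) by (simp add: wr_carrier_iff)
    have "snd (W.wprod ?new) = snd u \<otimes>\<^bsub>G\<^esub> snd v"
      unfolding prod_new snd_mult mid(3) using uvc snd_closed by simp
    also have "\<dots> = snd (u \<otimes>\<^bsub>W\<^esub> v)" by (simp add: snd_mult)
    finally show "snd (W.wprod ?new) = snd (f, \<one>\<^bsub>G\<^esub>)" by (simp add: prod_uv)
  next
    fix \<gamma> assume \<gamma>: "\<gamma> \<in> carrier G"
    \<comment> \<open>\<open>\<beta>\<close> is \<open>\<gamma>\<close> seen from the cursor
      position \<open>y\<close> reached by \<open>us\<close>; the new leaf \<open>x\<close>
      corresponds to \<open>s\<close>.\<close>
    define \<beta> where "\<beta> = inv\<^bsub>G\<^esub> y \<otimes>\<^bsub>G\<^esub> \<gamma>"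
    have \<beta>: "\<beta> \<in> carrier G" "y \<otimes>\<^bsub>G\<^esub> \<beta> = \<gamma>"
      using \<gamma> c by (simp_all add: \<beta>_def G.m_assoc[symmetric])
    have uc: "fst u \<gamma> \<in> carrier H" "fst v \<beta> \<in> carrier H" using uvc \<gamma> \<beta> fst_closed by auto
    have old: "fst u \<gamma> \<otimes>\<^bsub>H\<^esub> fst v \<beta> = f' \<gamma>"
      using fst_mult[OF \<gamma>, of u v] by (simp add: prod_uv u \<beta>_def)
    have "fst (W.wprod ?new) \<gamma> = fst u \<gamma> \<otimes>\<^bsub>H\<^esub> (fst (W.wprod mid) \<beta> \<otimes>\<^bsub>H\<^esub> fst v \<beta>)"
      unfolding prod_new using \<gamma> \<beta>(1) by (simp add: fst_mult u mid(3) \<beta>_def[symmetric])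
    also have "\<dots> = f \<gamma>"
    proof (cases "\<gamma> = x")
      case True
      then have "\<beta> = s" using \<beta> c by (simp add: x_def)
      have ab: "a \<otimes>\<^bsub>H\<^esub> fst v \<beta> = \<one>\<^bsub>H\<^esub>" using old True by (simp add: f'_def a_def)
      have "a \<otimes>\<^bsub>H\<^esub> (h \<otimes>\<^bsub>H\<^esub> fst v \<beta>) = (a \<otimes>\<^bsub>H\<^esub> inv\<^bsub>H\<^esub> a) \<otimes>\<^bsub>H\<^esub> f x \<otimes>\<^bsub>H\<^esub> (a \<otimes>\<^bsub>H\<^esub> fst v \<beta>)"
        unfolding h_def using a fx uc(2) by (simp only: H.m_assoc H.m_closed H.inv_closed)
      also have "\<dots> = f x" unfolding ab using a fx by simp
      finally show ?thesis using True \<beta>(1) \<open>\<beta> = s\<close> by (simp add: mid(4) a_def)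
    next
      case False
      then have "\<beta> \<noteq> s" using \<beta> by (auto simp: x_def)
      then show ?thesis using False \<beta>(1) uc old by (simp add: mid(4) f'_def)
    qed
    finally show "fst (W.wprod ?new) \<gamma> = fst (f, \<one>\<^bsub>G\<^esub>) \<gamma>" by simp
  qed
  moreover have "length ?new \<le> 3 * card (insert x T)"
    using ws(2) uv(1) mid(2) T(1) xT by simp
  moreover have "\<exists>us' vs'. ?new = us' @ vs' \<and> snd (W.wprod us') = z" if "z \<in> insert x T" for z
  proof (cases "z = x")
    case True
    have "W.wprod (us @ [wr_embG H G s]) = u \<otimes>\<^bsub>W\<^esub> wr_embG H G s"
      using W.wprod_append[OF let_uv(1), of "[wr_embG H G s]"] embs embG_closed[OF c(2)]
      by (simp add: u_def)
    then have "snd (W.wprod (us @ [wr_embG H G s])) = z"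
      using True by (simp add: snd_mult u wr_embG_def x_def)
    then show ?thesis by (intro exI[of _ "us @ [wr_embG H G s]"] exI[of _ "ms @ vs"]) (simp add: mid_def)
  next
    case False
    then have "z \<in> T" using that by simp
    then obtain us' vs' where uv': "ws = us' @ vs'" "snd (W.wprod us') = z" using ws(4) by blast
    then have "us @ vs = us' @ vs'" using uv(1) by simp
    \<comment> \<open>The old visit ends inside \<open>us\<close> or inside \<open>vs\<close>. In
      the second case the detour is inserted before it; as the detour returns the cursor to
      \<open>y\<close>, the visited point is unchanged.\<close>
    then consider w where "us = us' @ w" | w where "us' = us @ w" "vs = w @ vs'"
      by (auto simp: append_eq_append_conv2)
    then show ?thesis
    proof cases
      case 1
      then show ?thesis using uv'(2) by (intro exI[of _ us'] exI[of _ "w @ mid @ vs"]) simp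
    next
      case 2
      have w: "set w \<subseteq> W.letters" using 2 let_uv by auto
      have wc: "W.wprod w \<in> carrier W" using W.wprod_closed[OF w] .
      have "W.wprod (us @ mid @ w) = u \<otimes>\<^bsub>W\<^esub> (W.wprod mid \<otimes>\<^bsub>W\<^esub> W.wprod w)"
        using W.wprod_append[of us "mid @ w"] W.wprod_append[of mid w] let_uv mid(1) w
        by (simp add: u_def)
      then have "snd (W.wprod (us @ mid @ w)) = snd u \<otimes>\<^bsub>G\<^esub> snd (W.wprod w)"
        using snd_closed[OF wc] by (simp add: snd_mult mid(3))
      also have "\<dots> = z"
        using W.wprod_append[OF let_uv(1) w] uv'(2) 2(1) by (simp add: snd_mult u_def)
      finally show ?thesis using 2 by (intro exI[of _ "us @ mid @ w"] exI[of _ vs']) simp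
    qed
  qed
  ultimately show ?case using let_new unfolding x_def by blast
qed

text \<open>A tour of a ball containing the support sets all lamps and returns to the identity; a
  shortest word in \<open>G\<close> then moves the cursor. This gives both generation and the length
  estimate.\<close>

lemma ex_word:
  assumes x: "x \<in> carrier W" and N: "\<And>\<gamma>. \<gamma> \<in> carrier G \<Longrightarrow> fst x \<gamma> \<noteq> \<one>\<^bsub>H\<^esub> \<Longrightarrow> G.wl \<gamma> \<le> N"
  obtains ws where "set ws \<subseteq> W.letters" "W.wprod ws = x"
    "length ws \<le> 3 * card (G.wball N) + G.wl (snd x)"
proof -
  have c: "snd x \<in> carrier G" using snd_closed[OF x] .
  have f1: "fst x \<gamma> = \<one>\<^bsub>H\<^esub>" if "\<gamma> \<notin> G.wball N" for \<gamma>
    using that N x by (cases "\<gamma> \<in> carrier G") (auto simp: G.wball_def wreath_simps wr_carrier_iff)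
  have f2: "fst x \<gamma> \<in> carrier H" for \<gamma>
    using x by (cases "\<gamma> \<in> carrier G") (auto simp: wreath_simps wr_carrier_iff)
  obtain us where us: "set us \<subseteq> W.letters" "length us \<le> 3 * card (G.wball N)"
    "W.wprod us = (fst x, \<one>\<^bsub>G\<^esub>)"
    using tour_word[OF G.rooted_subtree_wball[OF finite_gens, of N], of "fst x", OF f2 f1] by blast
  obtain vs where vs: "set vs \<subseteq> G.letters" "G.wprod vs = snd x" "length vs = G.wl (snd x)"
    using G.wl_word[OF c] .
  define vs' where "vs' = map (wr_embG H G) vs"
  have vs': "set vs' \<subseteq> W.letters" unfolding letters_eq vs'_def using vs(1) by auto
  have "W.wprod (us @ vs') = (fst x, \<one>\<^bsub>G\<^esub>) \<otimes>\<^bsub>W\<^esub> wr_embG H G (snd x)"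
    using W.wprod_append[OF us(1) vs'] us(3) wprod_map_embG[OF vs(1)] vs(2) by (simp add: vs'_def)
  also have "\<dots> = x"
  proof (rule prod_eqI)
    show "fst ((fst x, \<one>\<^bsub>G\<^esub>) \<otimes>\<^bsub>W\<^esub> wr_embG H G (snd x)) = fst x"
      using f2 x by (auto simp: wreath_simps wr_mult_def wr_embG_def fun_eq_iff wr_carrier_iff)
    show "snd ((fst x, \<one>\<^bsub>G\<^esub>) \<otimes>\<^bsub>W\<^esub> wr_embG H G (snd x)) = snd x"
      using c by (simp add: snd_mult wr_embG_def)
  qed
  finally show thesis
    using that[of "us @ vs'"] us vs' vs by (simp add: vs'_def)
qed

end

text \<open>A finite support lies in some ball, so the tour words reach every element.\<close>

sublocale wreath_word_group \<subseteq> W: word_group "wreath H G" "wr_gens H G S"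
proof
  fix x assume x: "x \<in> carrier W"
  define F where "F = {\<gamma> \<in> carrier G. fst x \<gamma> \<noteq> \<one>\<^bsub>H\<^esub>}"
  have "finite (G.wl ` F)" using x by (simp add: wreath_simps wr_carrier_iff F_def)
  then obtain N where "\<forall>n\<in>G.wl ` F. n \<le> N" using finite_nat_set_iff_bounded_le by blast
  then have "G.wl \<gamma> \<le> N" if "\<gamma> \<in> carrier G" "fst x \<gamma> \<noteq> \<one>\<^bsub>H\<^esub>" for \<gamma>
    using that by (auto simp: F_def)
  then show "\<exists>ws. set ws \<subseteq> W.letters \<and> W.wprod ws = x" using ex_word[OF x] by metis
qed

section \<open>Linear control\<close>

context wreath_word_group
begin

lemma W_wl_support:
  assumes "x \<in> carrier W"
  shows "G.wl (snd x) \<le> W.wl x"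
    and "\<gamma> \<in> carrier G \<Longrightarrow> fst x \<gamma> \<noteq> \<one>\<^bsub>H\<^esub> \<Longrightarrow> G.wl \<gamma> \<le> W.wl x"
proof -
  obtain ws where ws: "set ws \<subseteq> W.letters" "W.wprod ws = x" "length ws = W.wl x"
    using W.wl_word[OF assms] .
  from word_support[OF ws(1)] ws show "G.wl (snd x) \<le> W.wl x"
    "\<gamma> \<in> carrier G \<Longrightarrow> fst x \<gamma> \<noteq> \<one>\<^bsub>H\<^esub> \<Longrightarrow> G.wl \<gamma> \<le> W.wl x" by auto
qed

lemma snd_inv_mult:
  "x \<in> carrier W \<Longrightarrow> snd (inv\<^bsub>W\<^esub> x \<otimes>\<^bsub>W\<^esub> y) = inv\<^bsub>G\<^esub> (snd x) \<otimes>\<^bsub>G\<^esub> snd y"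
  by (simp add: snd_mult snd_inv)

text \<open>The projection to \<open>G\<close> is 1-Lipschitz, which is what pulling back covers and
  projecting paths rests on.\<close>

lemma wdist_snd_le:
  assumes "x \<in> carrier W" "y \<in> carrier W"
  shows "G.wdist (snd x) (snd y) \<le> W.wdist x y"
  using W_wl_support(1)[of "inv\<^bsub>W\<^esub> x \<otimes>\<^bsub>W\<^esub> y"] assms
  by (simp add: G.wdist_def W.wdist_def snd_inv_mult)

text \<open>Each step changes only lamps within \<open>n\<close> of the current cursor, and the
  cursor stays within \<open>D\<close> of its start. So, relative to \<open>x\<close>, all changed
  lamps lie in the ball of radius \<open>D + n\<close> however long the path is, and a tour of that
  ball gives the bound.\<close>

lemma wdist_le_of_reachable:
  assumes Y: "Y \<subseteq> carrier W" "x \<in> Y" and reach: "W.reachable n Y x y"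
    and D: "\<And>w. W.reachable n Y x w \<Longrightarrow> G.wdist (snd x) (snd w) \<le> D"
  shows "W.wdist x y \<le> 3 * card (G.wball (D + n)) + D"
proof -
  have x: "x \<in> carrier W" using Y by blast
  have supp: "\<forall>\<gamma>\<in>carrier G. fst (inv\<^bsub>W\<^esub> x \<otimes>\<^bsub>W\<^esub> y) \<gamma> \<noteq> \<one>\<^bsub>H\<^esub> \<longrightarrow> G.wl \<gamma> \<le> D + n"
    using reach
  proof (induction rule: rtranclp_induct)
    case base
    then show ?case using W.l_inv[OF x] by (simp add: wreath_simps(3))
  next
    case (step y z)
    have yz: "y \<in> carrier W" "z \<in> carrier W"
      using W.reachable_closed[OF step(1) Y(2)] step(2) Y(1) by auto
    let ?p = "inv\<^bsub>W\<^esub> x \<otimes>\<^bsub>W\<^esub> y" and ?q = "inv\<^bsub>W\<^esub> y \<otimes>\<^bsub>W\<^esub> z"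
    have pq: "?p \<in> carrier W" "?q \<in> carrier W" using x yz by auto
    have g: "snd ?p \<in> carrier G" "G.wl (snd ?p) \<le> D"
      using snd_closed[OF pq(1)] D[OF step(1)] x by (simp_all add: G.wdist_def snd_inv_mult)
    have q: "W.wl ?q \<le> n" using step(2) by (simp add: W.wdist_def)
    show ?case
    proof (intro ballI impI)
      fix \<gamma> assume \<gamma>: "\<gamma> \<in> carrier G" "fst (inv\<^bsub>W\<^esub> x \<otimes>\<^bsub>W\<^esub> z) \<gamma> \<noteq> \<one>\<^bsub>H\<^esub>"
      let ?\<beta> = "inv\<^bsub>G\<^esub> (snd ?p) \<otimes>\<^bsub>G\<^esub> \<gamma>"
      have \<beta>: "?\<beta> \<in> carrier G" "snd ?p \<otimes>\<^bsub>G\<^esub> ?\<beta> = \<gamma>"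
        using g \<gamma> by (simp_all add: G.m_assoc[symmetric])
      have "fst ?p \<gamma> \<otimes>\<^bsub>H\<^esub> fst ?q ?\<beta> \<noteq> \<one>\<^bsub>H\<^esub>"
        using \<gamma>(2) fst_mult[OF \<gamma>(1), of ?p ?q] W.inv_mult_split[OF x yz] by simp
      then consider "fst ?p \<gamma> \<noteq> \<one>\<^bsub>H\<^esub>" | "fst ?q ?\<beta> \<noteq> \<one>\<^bsub>H\<^esub>" by fastforce
      then show "G.wl \<gamma> \<le> D + n"
      proof cases
        case 1
        then show ?thesis using step.IH \<gamma>(1) by blast
      next
        case 2
        then have "G.wl ?\<beta> \<le> n" using W_wl_support(2)[OF pq(2) \<beta>(1)] q by linarith
        with G.wl_mult[OF g(1) \<beta>(1)] \<beta>(2) g(2) show ?thesis by simp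
      qed
    qed
  qed
  have y: "y \<in> carrier W" using W.reachable_closed[OF reach Y(2)] Y(1) by blast
  have "inv\<^bsub>W\<^esub> x \<otimes>\<^bsub>W\<^esub> y \<in> carrier W" using x y by simp
  then obtain ws where ws: "set ws \<subseteq> W.letters" "W.wprod ws = inv\<^bsub>W\<^esub> x \<otimes>\<^bsub>W\<^esub> y"
    "length ws \<le> 3 * card (G.wball (D + n)) + G.wl (snd (inv\<^bsub>W\<^esub> x \<otimes>\<^bsub>W\<^esub> y))"
    using ex_word[of "inv\<^bsub>W\<^esub> x \<otimes>\<^bsub>W\<^esub> y" "D + n"] supp by blast
  have "G.wl (snd (inv\<^bsub>W\<^esub> x \<otimes>\<^bsub>W\<^esub> y)) \<le> D"
    using D[OF reach] x by (simp add: G.wdist_def snd_inv_mult)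
  then show ?thesis using W.wl_le[OF ws(1)] ws(2,3) by (simp add: W.wdist_def)
qed

text \<open>The cursor is always at the identity, so the previous estimate applies with
  \<open>D = 0\<close> and the whole kernel serves as the single set at every scale.\<close>

lemma kernel_linear_control:
  assumes A: "\<And>n. 1 \<le> n \<Longrightarrow> card (G.wball n) \<le> A * n"
  shows "has_linear_control (wr_kernel H G) (word_dist W (wr_gens H G S)) 0"
proof -
  have sub: "wr_kernel H G \<subseteq> carrier W" by (auto simp: wr_kernel_def wreath_simps)
  interpret K: nat_metric "wr_kernel H G" W.wdist
    by unfold_locales (use sub in \<open>auto intro!: W.wdist_refl W.wdist_sym W.wdist_triangle\<close>)
  have "K.nat_control 0 (3 * A)"
    unfolding K.nat_control_def
  proof (intro allI impI)
    fix n :: nat assume n: "1 \<le> n"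
    have "W.wdist x y \<le> 3 * A * n"
      if x: "x \<in> wr_kernel H G" and reach: "W.reachable n (wr_kernel H G) x y" for x y
    proof -
      have "G.wdist (snd x) (snd w) \<le> 0" if "W.reachable n (wr_kernel H G) x w" for w
        using W.reachable_closed[OF that x] x by (simp add: wr_kernel_def G.wdist_refl)
      from wdist_le_of_reachable[OF sub x reach this] A[OF n] show ?thesis by simp
    qed
    then show "\<exists>U :: nat \<Rightarrow> _. (\<forall>i\<le>0. U i \<subseteq> wr_kernel H G) \<and>
        (\<forall>x\<in>wr_kernel H G. \<exists>i\<le>0. {y \<in> wr_kernel H G. W.wdist x y \<le> n} \<subseteq> U i) \<and>
        (\<forall>i\<le>0. \<forall>x\<in>U i. \<forall>y. W.reachable n (U i) x y \<longrightarrow> W.wdist x y \<le> 3 * A * n)"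
      by (intro exI[of _ "\<lambda>_. wr_kernel H G"]) auto
  qed
  from K.nat_control_imp_linear_control[OF this] show ?thesis by (simp add: W.word_dist_eq[abs_def])
qed

text \<open>The sets are preimages of a cover of \<open>G\<close>. Within a component the cursor
  moves by at most \<open>C * n\<close>; a tour of the ball of radius \<open>C * n + n\<close> costs
  at most \<open>3 * A * (C + 1) * n\<close> letters, and the last summand \<open>C\<close> accounts
  for placing the cursor.\<close>

lemma wreath_nat_control:
  assumes A: "\<And>n. 1 \<le> n \<Longrightarrow> card (G.wball n) \<le> A * n" and C: "G.nat_control k C"
  shows "W.nat_control k (3 * A * (C + 1) + C)"
  unfolding W.nat_control_def
proof (intro allI impI)
  fix n :: nat assume n: "1 \<le> n"
  obtain U where U: "\<forall>i\<le>k. U i \<subseteq> carrier G"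
    "\<forall>x\<in>carrier G. \<exists>i\<le>k. G.closed_ball x n \<subseteq> U i"
    "\<forall>i\<le>k. \<forall>x\<in>U i. \<forall>y. G.reachable n (U i) x y \<longrightarrow> G.wdist x y \<le> C * n"
    using C[unfolded G.nat_control_def, rule_format, OF n] by (elim exE conjE)
  define V where "V i = {x \<in> carrier W. snd x \<in> U i}" for i
  have V: "V i \<subseteq> carrier W" for i by (auto simp: V_def)
  have proj: "G.reachable n (U i) (snd x) (snd y)" if "x \<in> V i" "W.reachable n (V i) x y" for i x y
    using that(2)
  proof (induction rule: rtranclp_induct)
    case (step y z)
    have "y \<in> carrier W" "z \<in> V i" "z \<in> carrier W" "W.wdist y z \<le> n"
      using W.reachable_closed[OF step(1) that(1)] step(2) V by auto
    then have "snd z \<in> U i \<and> G.wdist (snd y) (snd z) \<le> n"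
      using wdist_snd_le[of y z] by (simp add: V_def)
    with step.IH show ?case by (rule rtranclp.rtrancl_into_rtrancl)
  qed simp
  have comp: "W.wdist x y \<le> (3 * A * (C + 1) + C) * n"
    if i: "i \<le> k" and x: "x \<in> V i" and reach: "W.reachable n (V i) x y" for i x y
  proof -
    have "snd x \<in> U i" using x by (simp add: V_def)
    then have "G.wdist (snd x) (snd w) \<le> C * n" if "W.reachable n (V i) x w" for w
      using U(3) i proj[OF x that] by blast
    from wdist_le_of_reachable[OF V x reach this]
    have "W.wdist x y \<le> 3 * card (G.wball (C * n + n)) + C * n" .
    also have "\<dots> \<le> 3 * (A * (C * n + n)) + C * n" using A[of "C * n + n"] n by simp
    finally show ?thesis by (simp add: algebra_simps)
  qed
  have cover: "\<exists>i\<le>k. W.closed_ball x n \<subseteq> V i" if x: "x \<in> carrier W" for x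
  proof -
    obtain i where i: "i \<le> k" "G.closed_ball (snd x) n \<subseteq> U i" using U(2) snd_closed[OF x] by blast
    have "y \<in> V i" if "y \<in> W.closed_ball x n" for y
    proof -
      have y: "y \<in> carrier W" "W.wdist x y \<le> n" using that by auto
      then have "snd y \<in> G.closed_ball (snd x) n"
        using wdist_snd_le[OF x y(1)] snd_closed[OF y(1)] by simp
      with i(2) y(1) show ?thesis unfolding V_def by blast
    qed
    with i(1) show ?thesis by blast
  qed
  show "\<exists>U :: nat \<Rightarrow> _. (\<forall>i\<le>k. U i \<subseteq> carrier W) \<and>
      (\<forall>x\<in>carrier W. \<exists>i\<le>k. W.closed_ball x n \<subseteq> U i) \<and>
      (\<forall>i\<le>k. \<forall>x\<in>U i. \<forall>y. W.reachable n (U i) x y \<longrightarrow> W.wdist x y \<le> (3 * A * (C + 1) + C) * n)"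
    using V cover comp by (intro exI[of _ V]) simp
qed

lemma infinite_wreath:
  assumes "infinite (carrier G)"
  shows "infinite (carrier W)"
proof
  assume "finite (carrier W)"
  moreover have "carrier G \<subseteq> snd ` carrier W"
  proof
    fix g assume "g \<in> carrier G"
    from embG_closed[OF this] show "g \<in> snd ` carrier W"
      by (rule rev_image_eqI) (simp add: wr_embG_def)
  qed
  ultimately show False using assms finite_surj by blast
qed

end

section \<open>Values of the dimension\<close>

lemma dim_AN_eq_0: "has_linear_control M d 0 \<Longrightarrow> dim_AN M d = 0"
  by (auto simp: dim_AN_def zero_enat_def)

lemma dim_AN_eq_1:
  assumes "has_linear_control M d 1" "\<not> has_linear_control M d 0"
  shows "dim_AN M d = 1"
proof -
  have "(LEAST n. has_linear_control M d n) = 1"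
    using assms by (intro Least_equality) (auto intro: Suc_leI gr0I)
  with assms(1) show ?thesis by (auto simp: dim_AN_def one_enat_def)
qed

theorem theorem5p1:
  fixes G :: "('g, 'd) monoid_scheme" and H :: "('h, 'c) monoid_scheme" and S :: "'g set"
  assumes "group G" and "infinite (carrier G)"
    and "finite S" and "S \<subseteq> carrier G" and "generate G S = carrier G"
    and "group H" and "finite (carrier H)"
    and "linear_growth G S"
  shows "dim_AN (wr_kernel H G) (word_dist (wreath H G) (wr_gens H G S)) = 0
       \<and> dim_AN (carrier (wreath H G)) (word_dist (wreath H G) (wr_gens H G S)) = 1
       \<and> dim_AN (carrier G) (word_dist G S) = 1"
proof -
  interpret G: gens_group G S using assms by (intro gens_group.intro gens_group_axioms.intro)
  interpret G: word_group G S using G.word_group_generate assms by blast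
  interpret H: group H by fact
  interpret wreath_word_group G S H by unfold_locales fact
  obtain A where A: "\<And>n. 1 \<le> n \<Longrightarrow> card (G.wball n) \<le> A * n"
    using G.linear_growth_card_wball[OF assms(8)] by blast
  obtain C where C: "G.nat_control 1 C" using G.linear_growth_nat_control assms by blast
  \<comment> \<open>Finiteness of \<open>H\<close> makes the generating set finite, so that balls in
    the wreath product are finite, as the exclusion of dimension 0 requires.\<close>
  have "finite (wr_gens H G S)" using assms(3,7) by (simp add: wr_gens_def)
  then have "\<not> has_linear_control (carrier W) (word_dist W (wr_gens H G S)) 0"
    using W.not_has_linear_control_0 infinite_wreath[OF assms(2)] by blast
  moreover have "has_linear_control (carrier W) (word_dist W (wr_gens H G S)) 1"
    using W.nat_control_imp_linear_control[OF wreath_nat_control[OF A C]]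
    by (simp add: W.word_dist_eq[abs_def])
  moreover have "has_linear_control (carrier G) (word_dist G S) 1"
    using G.nat_control_imp_linear_control[OF C] by (simp add: G.word_dist_eq[abs_def])
  ultimately show ?thesis
    using kernel_linear_control[OF A] G.not_has_linear_control_0[OF assms(3,2)]
    by (simp add: dim_AN_eq_0 dim_AN_eq_1)
qed

end
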